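(* Let $\Gamma$ be a tropical curve, $D$ a divisor on $\Gamma$, and $\mathcal F=(f_1,\dots,f_r)$ a finite set of generators of $R(D)$ as a tropical semi-module. Let $\phi_{\mathcal F}:\Gamma\to\mathbb{TP}^{r-1}$ be the map $x\mapsto(f_1(x),\dots,f_r(x))$. Then the linear system $|D|$ (equivalently $R(D)/\mathbf 1$) is homeomorphic to the tropical convex hull of the image of $\phi_{\mathcal F}$.
   Context: A tropical curve $\Gamma$ is a compact connected metric graph whose leaf edges may have infinite length. A divisor is a finite formal $\mathbb Z$-combination of points. A rational function is a continuous function $f:\Gamma\to\mathbb R$, piecewise linear with finitely many pieces and integer slopes; $(f)=\sum_x\mathrm{ord}_x(f)\cdot x$ where $\mathrm{ord}_x(f)$ is the sum of outgoing slopes at $x$. $R(D)\subset\mathbb R^\Gamma$ is the set of rational functions with $D+(f)\ge0$, and $|D|=\{D+(f):f\in R(D)\}$, a subset of the $d$-th symmetric product of $\Gamma$, $d=\deg D$. The map $f\mapsto D+(f)$ identifies $R(D)/\mathbf 1$ homeomorphically with $|D|$, where $/\mathbf 1$ means modulo addition of real constant functions and $R(D)/\mathbf{1}\subset\mathbb R^\Gamma/\mathbf 1$. Tropical operations: $\oplus=\max$, $\odot=+$ (pointwise/coordinatewise). $\mathcal F$ generates $R(D)$ if every element of $R(D)$ is of the form $(a_1\odot f_1)\oplus\cdots\oplus(a_r\odot f_r)$ with $a_i\in\mathbb{R}$ (some terms may be omitted). $\mathbb{TP}^{r-1}=\mathbb R^r/\mathbb R(1,\dots,1)$. The tropical convex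 hull of a set in $\mathbb{TP}^{r-1}$ is the (image in $\mathbb{TP}^{r-1}$ of the) tropical semi-module generated by the set, i.e. the set of all its finite tropical linear combinations. *)

theory Defs
  imports "HOL-Analysis.Analysis" "HOL-Library.Poly_Mapping"
begin

section \<open>Quotient topologies\<close>

definition quotient_topology :: "'a topology \<Rightarrow> ('a \<Rightarrow> 'b) \<Rightarrow> 'b topology" where
  "quotient_topology X q =
     topology (\<lambda>U. U \<subseteq> q ` topspace X \<and> openin X {x \<in> topspace X. q x \<in> U})"

lemma openin_quotient_topology:
  "openin (quotient_topology X q) U \<longleftrightarrow>
     U \<subseteq> q ` topspace X \<and> openin X {x \<in> topspace X. q x \<in> U}"
proof -
  have "istopology (\<lambda>U. U \<subseteq> q ` topspace X \<and> openin X {x \<in> topspace X. q x \<in> U})"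
    unfolding istopology_def
  proof (rule conjI; intro allI impI)
    fix S T
    assume S: "S \<subseteq> q ` topspace X \<and> openin X {x \<in> topspace X. q x \<in> S}"
      and T: "T \<subseteq> q ` topspace X \<and> openin X {x \<in> topspace X. q x \<in> T}"
    have "{x \<in> topspace X. q x \<in> S \<inter> T}
        = {x \<in> topspace X. q x \<in> S} \<inter> {x \<in> topspace X. q x \<in> T}" by auto
    with S T show "S \<inter> T \<subseteq> q ` topspace X \<and> openin X {x \<in> topspace X. q x \<in> S \<inter> T}"
      by auto
  next
    fix \<K>
    assume K: "\<forall>K\<in>\<K>. K \<subseteq> q ` topspace X \<and> openin X {x \<in> topspace X. q x \<in> K}"
    have "{x \<in> topspace X. q x \<in> \<Union>\<K>} = (\<Union>K\<in>\<K>. {x \<in> topspace X. q x \<in> K})" by auto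
    with K show "\<Union>\<K> \<subseteq> q ` topspace X \<and> openin X {x \<in> topspace X. q x \<in> \<Union>\<K>}"
      by auto
  qed
  then show ?thesis
    unfolding quotient_topology_def by (simp add: topology_inverse')
qed

lemma topspace_quotient_topology [simp]:
  "topspace (quotient_topology X q) = q ` topspace X"
proof
  show "topspace (quotient_topology X q) \<subseteq> q ` topspace X"
    by (auto simp: topspace_def openin_quotient_topology)
  have "{x \<in> topspace X. q x \<in> q ` topspace X} = topspace X" by auto
  then have "openin (quotient_topology X q) (q ` topspace X)"
    by (simp add: openin_quotient_topology)
  then show "q ` topspace X \<subseteq> topspace (quotient_topology X q)"
    by (rule openin_subset)
qed

lemma quotient_map_quotient_topology: "quotient_map X (quotient_topology X q) q"
  by (auto simp: quotient_map_def openin_quotient_topology)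


section \<open>Tropical curves\<close>

text \<open>
  A metric graph is given by a finite multigraph (loops and parallel edges allowed) with arbitrarily
  oriented edges and an edge length in \<open>(0,\<infinity>]\<close>. An edge \<open>e\<close> is the interval
  \<open>[0, len e]\<close>, with \<open>0\<close> glued to \<open>src e\<close> and \<open>len e\<close> glued to
  \<open>tgt e\<close>; if \<open>len e = \<infinity>\<close>, then \<open>tgt e\<close> is the point at infinity.
\<close>

record ('v, 'e) metric_graph =
  verts :: "'v set"
  edges :: "'e set"
  src :: "'e \<Rightarrow> 'v"
  tgt :: "'e \<Rightarrow> 'v"
  len :: "'e \<Rightarrow> ereal"

datatype ('v, 'e) point = Vertex 'v | Inner 'e real

definition edge_interior :: "('v, 'e) metric_graph \<Rightarrow> 'e \<Rightarrow> real set" where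
  "edge_interior G e = {t. 0 < t \<and> ereal t < len G e}"

definition points :: "('v, 'e) metric_graph \<Rightarrow> ('v, 'e) point set" where
  "points G = Vertex ` verts G \<union> {Inner e t | e t. e \<in> edges G \<and> t \<in> edge_interior G e}"

definition edge_map :: "('v, 'e) metric_graph \<Rightarrow> 'e \<Rightarrow> ereal \<Rightarrow> ('v, 'e) point" where
  "edge_map G e s =
     (if s = 0 then Vertex (src G e)
      else if s = len G e then Vertex (tgt G e)
      else Inner e (real_of_ereal s))"

text \<open>The quotient of the disjoint union of the vertices and the compact intervals
  \<open>[0, len e]\<close>, which for \<open>len e = \<infinity>\<close> are taken in the extended reals.\<close>

definition curve_topology :: "('v, 'e) metric_graph \<Rightarrow> ('v, 'e) point topology" where
  "curve_topology G =
     topology (\<lambda>U. U \<subseteq> points G \<and>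
       (\<forall>e\<in>edges G. openin (top_of_set {0..len G e}) {s \<in> {0..len G e}. edge_map G e s \<in> U}))"

lemma openin_curve_topology:
  "openin (curve_topology G) U \<longleftrightarrow> U \<subseteq> points G \<and>
     (\<forall>e\<in>edges G. openin (top_of_set {0..len G e}) {s \<in> {0..len G e}. edge_map G e s \<in> U})"
proof -
  have "istopology (\<lambda>U. U \<subseteq> points G \<and>
     (\<forall>e\<in>edges G. openin (top_of_set {0..len G e}) {s \<in> {0..len G e}. edge_map G e s \<in> U}))"
    (is "istopology ?P")
    unfolding istopology_def
  proof (rule conjI; intro allI impI)
    fix S T assume S: "?P S" and T: "?P T"
    have "{s \<in> {0..len G e}. edge_map G e s \<in> S \<inter> T}
        = {s \<in> {0..len G e}. edge_map G e s \<in> S} \<inter> {s \<in> {0..len G e}. edge_map G e s \<in> T}" for e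
      by auto
    with S T show "?P (S \<inter> T)" by (metis (no_types, lifting) inf.coboundedI1 openin_Int)
  next
    fix \<K> assume K: "\<forall>K\<in>\<K>. ?P K"
    have "{s \<in> {0..len G e}. edge_map G e s \<in> \<Union>\<K>}
        = (\<Union>K\<in>\<K>. {s \<in> {0..len G e}. edge_map G e s \<in> K})" for e by auto
    with K show "?P (\<Union>\<K>)" by (auto intro!: openin_Union)
  qed
  then show ?thesis
    unfolding curve_topology_def by (simp add: topology_inverse')
qed

text \<open>
  An infinite edge must end in a one-valent vertex. A leaf edge that is infinite in both directions
  is covered by placing a vertex in its middle.
\<close>

definition tropical_curve :: "('v, 'e) metric_graph \<Rightarrow> bool" where
  "tropical_curve G \<longleftrightarrow>
     finite (verts G) \<and> verts G \<noteq> {} \<and> finite (edges G) \<and>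
     (\<forall>e\<in>edges G. src G e \<in> verts G \<and> tgt G e \<in> verts G \<and> 0 < len G e) \<and>
     (\<forall>e\<in>edges G. len G e = \<infinity> \<longrightarrow>
        (\<forall>e'\<in>edges G. src G e' \<noteq> tgt G e \<and> (tgt G e' = tgt G e \<longrightarrow> e' = e))) \<and>
     connected_space (curve_topology G)"

lemma topspace_curve_topology:
  assumes "tropical_curve G"
  shows "topspace (curve_topology G) = points G"
proof
  show "topspace (curve_topology G) \<subseteq> points G"
    by (auto simp: topspace_def openin_curve_topology)
  have "edge_map G e s \<in> points G" if e: "e \<in> edges G" and s: "s \<in> {0..len G e}" for e s
  proof -
    have "src G e \<in> verts G" "tgt G e \<in> verts G"
      using assms e by (auto simp: tropical_curve_def)
    moreover have "real_of_ereal s \<in> edge_interior G e" if "s \<noteq> 0" "s \<noteq> len G e"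
      using s that by (cases s; cases "len G e") (auto simp: edge_interior_def)
    ultimately show ?thesis using e by (auto simp: edge_map_def points_def)
  qed
  then have "{s \<in> {0..len G e}. edge_map G e s \<in> points G} = {0..len G e}" if "e \<in> edges G" for e
    using that by auto
  then have "openin (curve_topology G) (points G)"
    by (simp add: openin_curve_topology)
  then show "points G \<subseteq> topspace (curve_topology G)"
    by (rule openin_subset)
qed


section \<open>Divisors and rational functions\<close>

text \<open>Divisors are elements of the free abelian group \<^typ>\<open>'a \<Rightarrow>\<^sub>0 int\<close> supported on the
  curve. Functions on the curve are \<^const>\<open>extensional\<close> on its set of points.\<close>

definition is_divisor :: "('v, 'e) metric_graph \<Rightarrow> (('v, 'e) point \<Rightarrow>\<^sub>0 int) \<Rightarrow> bool" where
  "is_divisor G D \<longleftrightarrow> Poly_Mapping.keys D \<subseteq> points G"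

definition div_degree :: "('a \<Rightarrow>\<^sub>0 int) \<Rightarrow> int" where
  "div_degree D = (\<Sum>x\<in>Poly_Mapping.keys D. Poly_Mapping.lookup D x)"

definition effective :: "('a \<Rightarrow>\<^sub>0 int) \<Rightarrow> bool" where
  "effective D \<longleftrightarrow> (\<forall>x. 0 \<le> Poly_Mapping.lookup D x)"

text \<open>On every interval of an edge that avoids the finite set \<open>B\<close> of breakpoints,
  \<open>f\<close> is affine with integer slope.\<close>

definition rational_function ::
    "('v, 'e) metric_graph \<Rightarrow> (('v, 'e) point \<Rightarrow> real) \<Rightarrow> bool" where
  "rational_function G f \<longleftrightarrow>
     f \<in> extensional (points G) \<and>
     continuous_map (curve_topology G) euclideanreal f \<and>
     (\<forall>e\<in>edges G. \<exists>B. finite B \<and>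
        (\<forall>I. is_interval I \<and> I \<subseteq> edge_interior G e - B \<longrightarrow>
           (\<exists>(m::int) c. \<forall>t\<in>I. f (Inner e t) = of_int m * t + c)))"

text \<open>The slope of \<open>f\<close> on \<open>e\<close>, with respect to the parameter of \<open>e\<close>, near the end of the
  interval described by the filter; an outgoing slope in the decreasing direction is its negative.
  At a point at infinity it is the slope of \<open>f\<close> far out on the edge.\<close>

definition germ_slope :: "(('v, 'e) point \<Rightarrow> real) \<Rightarrow> 'e \<Rightarrow> real filter \<Rightarrow> int" where
  "germ_slope f e F = (THE m. \<exists>c. \<forall>\<^sub>F t in F. f (Inner e t) = of_int m * t + c)"

definition tgt_filter :: "('v, 'e) metric_graph \<Rightarrow> 'e \<Rightarrow> real filter" where
  "tgt_filter G e =
     (if len G e = \<infinity> then at_top else at_left (real_of_ereal (len G e)))"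

fun ord_at :: "('v, 'e) metric_graph \<Rightarrow> (('v, 'e) point \<Rightarrow> real) \<Rightarrow> ('v, 'e) point \<Rightarrow> int" where
  "ord_at G f (Inner e t) = germ_slope f e (at_right t) - germ_slope f e (at_left t)"
| "ord_at G f (Vertex v) =
     (\<Sum>e | e \<in> edges G \<and> src G e = v. germ_slope f e (at_right 0))
   - (\<Sum>e | e \<in> edges G \<and> tgt G e = v. germ_slope f e (tgt_filter G e))"

definition principal_divisor ::
    "('v, 'e) metric_graph \<Rightarrow> (('v, 'e) point \<Rightarrow> real) \<Rightarrow> (('v, 'e) point \<Rightarrow>\<^sub>0 int)" where
  "principal_divisor G f =
     (\<Sum>x | x \<in> points G \<and> ord_at G f x \<noteq> 0. frag_cmul (ord_at G f x) (frag_of x))"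

definition R_space ::
    "('v, 'e) metric_graph \<Rightarrow> (('v, 'e) point \<Rightarrow>\<^sub>0 int) \<Rightarrow> (('v, 'e) point \<Rightarrow> real) set" where
  "R_space G D = {f. rational_function G f \<and> effective (D + principal_divisor G f)}"

definition linear_system ::
    "('v, 'e) metric_graph \<Rightarrow> (('v, 'e) point \<Rightarrow>\<^sub>0 int) \<Rightarrow> (('v, 'e) point \<Rightarrow>\<^sub>0 int) set" where
  "linear_system G D = (\<lambda>f. D + principal_divisor G f) ` R_space G D"

text \<open>The \<open>d\<close>-th symmetric product: an unordered \<open>d\<close>-tuple is the formal sum of its entries.\<close>

definition sym_product :: "'a topology \<Rightarrow> nat \<Rightarrow> ('a \<Rightarrow>\<^sub>0 int) topology" where
  "sym_product X d =
     quotient_topology (product_topology (\<lambda>_. X) {..<d}) (\<lambda>p. \<Sum>i<d. frag_of (p i))"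

definition linear_system_topology ::
    "('v, 'e) metric_graph \<Rightarrow> (('v, 'e) point \<Rightarrow>\<^sub>0 int) \<Rightarrow> (('v, 'e) point \<Rightarrow>\<^sub>0 int) topology" where
  "linear_system_topology G D =
     subtopology (sym_product (curve_topology G) (nat (div_degree D))) (linear_system G D)"


section \<open>Tropical linear algebra\<close>

text \<open>
  For an index set \<open>I\<close>, elements of \<open>\<real>\<^sup>I\<close> are functions that are extensional on
  \<open>I\<close>. The quotient by the real constants is used both for the points of the curve
  and, with \<open>I = {..<r}\<close>, for tropical projective space.
\<close>

definition const_class :: "'i set \<Rightarrow> ('i \<Rightarrow> real) \<Rightarrow> ('i \<Rightarrow> real) set" where
  "const_class I f = {g. \<exists>c. g = (\<lambda>i\<in>I. f i + c)}"

definition mod_const :: "'i set \<Rightarrow> ('i \<Rightarrow> real) set topology" where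
  "mod_const I = quotient_topology (powertop_real I) (const_class I)"

definition tropical_span :: "'i set \<Rightarrow> ('i \<Rightarrow> real) set \<Rightarrow> ('i \<Rightarrow> real) set" where
  "tropical_span I A =
     {(\<lambda>i\<in>I. Max ((\<lambda>h. a h + h i) ` S)) | S a. finite S \<and> S \<noteq> {} \<and> S \<subseteq> A}"

text \<open>For a set \<open>B\<close> of classes, \<open>\<Union>B\<close> is the set of all their representatives.\<close>

definition tropical_hull :: "'i set \<Rightarrow> ('i \<Rightarrow> real) set set \<Rightarrow> ('i \<Rightarrow> real) set set" where
  "tropical_hull I B = const_class I ` tropical_span I (\<Union>B)"

definition R_mod_const ::
    "('v, 'e) metric_graph \<Rightarrow> (('v, 'e) point \<Rightarrow>\<^sub>0 int) \<Rightarrow> (('v, 'e) point \<Rightarrow> real) set topology" where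
  "R_mod_const G D =
     subtopology (mod_const (points G)) (const_class (points G) ` R_space G D)"

definition generates_R ::
    "('v, 'e) metric_graph \<Rightarrow> (('v, 'e) point \<Rightarrow>\<^sub>0 int) \<Rightarrow> nat
      \<Rightarrow> (nat \<Rightarrow> ('v, 'e) point \<Rightarrow> real) \<Rightarrow> bool" where
  "generates_R G D r F \<longleftrightarrow>
     F ` {..<r} \<subseteq> R_space G D \<and> R_space G D \<subseteq> tropical_span (points G) (F ` {..<r})"

definition phi :: "nat \<Rightarrow> (nat \<Rightarrow> 'x \<Rightarrow> real) \<Rightarrow> 'x \<Rightarrow> (nat \<Rightarrow> real) set" where
  "phi r F x = const_class {..<r} (\<lambda>i\<in>{..<r}. F i x)"

end

theory Submission
  imports Defs
begin

text \<open>
  Let \<open>f \<mapsto> y\<close> with \<open>y i = max\<^sub>x (F i x - f x)\<close>. This is inverse to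
  \<open>y \<mapsto> f\<close> with \<open>f x = max\<^sub>i (F i x - y i)\<close>, so the tropical span of the rows of the
  matrix \<open>F\<close> corresponds to that of its columns. The second map is continuous for pointwise
  convergence. Modulo constants the column span is compact, because
  \<open>y \<mapsto> f \<mapsto> y\<close> is a non-expansive retraction onto it and all its elements have
  oscillation at most \<open>2 sup \<bar>F\<bar>\<close>; hence the second map is a homeomorphism.

  For the linear system, a piecewise affine function \<open>\<phi>\<close> on the curve defines the continuous
  function \<open>E \<mapsto> \<Sum>x. E(x) \<phi>(x)\<close> on the symmetric product. These functions separate
  divisors, so they embed the compact symmetric product into a power of the reals. By Green's formula
  \<open>\<Sum>x. ord\<^sub>x(f) \<phi>(x)\<close> is a combination of finitely many values of \<open>f\<close>, so the composite
  with \<open>f \<mapsto> D + (f)\<close> is continuous on the compact space \<open>R(D)/1\<close>, and it is injective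
  there. Thus \<open>|D|\<close> and \<open>R(D)/1\<close> are embedded with the same image.
\<close>

section \<open>Representatives modulo constants\<close>

text \<open>Pointwise convergence on the curve hides compactness: \<open>R(D)/1\<close> sits in a
  power of the reals with one factor per point, and \<open>f \<mapsto> y\<close> takes a maximum
  over all points. Hence compactness is established on the side with \<open>r\<close> coordinates
  and transported by the map that is visibly continuous. The maxima over \<open>x\<close> exist, and
  sup |F| is finite, because the curve is compact and rational functions are real-valued and
  continuous also at points at infinity. Although \<open>y\<close> is a maximum over all points,
  \<open>r\<close> of them suffice, one for each coordinate, so the hull with its finite
  combinations is large enough. For divisors the obstacle is that slopes are not continuous under
  pointwise convergence. The test functions are constant near both ends of every edge, so in Green's
  formula the slopes at the ends cancel and only values of \<open>f\<close> at inner points remain,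
  on infinite edges too. Separating divisors also spares a direct proof that the symmetric product
  is Hausdorff.\<close>

definition based_at :: "'i set \<Rightarrow> 'i \<Rightarrow> ('i \<Rightarrow> real) \<Rightarrow> 'i \<Rightarrow> real" where
  "based_at I i0 f = (\<lambda>i\<in>I. f i - f i0)"

lemma based_at_apply [simp]: "i \<in> I \<Longrightarrow> based_at I i0 f i = f i - f i0"
  by (simp add: based_at_def)

lemma based_at_extensional [simp]: "based_at I i0 f \<in> extensional I"
  by (simp add: based_at_def)

lemma based_at_add_const [simp]: "i0 \<in> I \<Longrightarrow> based_at I i0 (\<lambda>i\<in>I. f i + c) = based_at I i0 f"
  by (auto simp: based_at_def)

lemma based_at_idem [simp]: "i0 \<in> I \<Longrightarrow> based_at I i0 (based_at I i0 f) = based_at I i0 f"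
  by (auto simp: based_at_def)

lemma based_at_eqD:
  assumes "based_at I i0 f = based_at I i0 g" "f \<in> extensional I"
  shows "f = (\<lambda>i\<in>I. g i + (f i0 - g i0))"
proof (rule extensionalityI[OF assms(2)])
  fix i assume i: "i \<in> I"
  then have "f i - f i0 = g i - g i0"
    using based_at_apply[OF i] assms(1) by metis
  then show "f i = (\<lambda>i\<in>I. g i + (f i0 - g i0)) i" using i by simp
qed simp

lemma const_class_based_at [simp]: "const_class I (based_at I i0 f) = const_class I f"
proof -
  have "(\<lambda>i\<in>I. f i + c) = (\<lambda>i\<in>I. based_at I i0 f i + (c + f i0))"
    and "(\<lambda>i\<in>I. based_at I i0 f i + c) = (\<lambda>i\<in>I. f i + (c - f i0))" for c
    by (auto simp: based_at_def)
  then show ?thesis unfolding const_class_def by fastforce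
qed

lemma continuous_map_based_at:
  assumes "i0 \<in> I"
  shows "continuous_map (powertop_real I) (powertop_real I) (based_at I i0)"
  unfolding continuous_map_componentwise based_at_def using assms
  by (auto intro!: continuous_intros continuous_map_product_projection)

text \<open>Normalisation at \<open>i0\<close> is continuous and constant on classes, so by the
  universal property it descends to a continuous map on the quotient. This map is a section of
  \<open>const_class\<close>, and the two restrict to mutually inverse continuous maps.\<close>

lemma homeomorphic_space_mod_const:
  assumes i0: "i0 \<in> I" and A: "A \<subseteq> extensional I"
  shows "subtopology (mod_const I) (const_class I ` A) homeomorphic_space
         subtopology (powertop_real I) (based_at I i0 ` A)"
proof -
  have ts: "topspace (powertop_real I) = extensional I" by (simp add: PiE_def)
  \<comment> \<open>Any representative will do, because \<open>based_at\<close> removes the additive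
    constant.\<close>
  define N where "N C = based_at I i0 (SOME f. f \<in> C)" for C
  have N: "N (const_class I f) = based_at I i0 f" for f
  proof -
    have "(\<lambda>i\<in>I. f i + 0) \<in> const_class I f" unfolding const_class_def by blast
    then have "(SOME g. g \<in> const_class I f) \<in> const_class I f" by (rule someI[of "\<lambda>g. g \<in> const_class I f"])
    then obtain c where "(SOME g. g \<in> const_class I f) = (\<lambda>i\<in>I. f i + c)"
      unfolding const_class_def by blast
    then show ?thesis using i0 by (simp add: N_def)
  qed
  have q: "quotient_map (powertop_real I) (mod_const I) (const_class I)"
    unfolding mod_const_def by (rule quotient_map_quotient_topology)
  have "N \<circ> const_class I = based_at I i0" by (auto simp: N)
  then have contN: "continuous_map (mod_const I) (powertop_real I) N"
    using continuous_compose_quotient_map_eq[OF q] continuous_map_based_at[OF i0] by metis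
  have "homeomorphic_maps (subtopology (mod_const I) (const_class I ` A))
          (subtopology (powertop_real I) (based_at I i0 ` A)) N (const_class I)"
    unfolding homeomorphic_maps_def
  proof (intro conjI)
    show "continuous_map (subtopology (mod_const I) (const_class I ` A))
        (subtopology (powertop_real I) (based_at I i0 ` A)) N"
      using contN by (auto simp: continuous_map_in_subtopology N continuous_map_from_subtopology)
    show "continuous_map (subtopology (powertop_real I) (based_at I i0 ` A))
        (subtopology (mod_const I) (const_class I ` A)) (const_class I)"
      using quotient_imp_continuous_map[OF q]
      by (auto simp: continuous_map_in_subtopology continuous_map_from_subtopology)
  qed (auto simp: N i0)
  then show ?thesis by (rule homeomorphic_maps_imp_homeomorphic_space)
qed

section \<open>Duality between the row and the column space\<close>

lemma continuous_map_Max: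
  fixes f :: "'i \<Rightarrow> 'a \<Rightarrow> real"
  assumes "finite I" "I \<noteq> {}" "\<And>i. i \<in> I \<Longrightarrow> continuous_map X euclideanreal (f i)"
  shows "continuous_map X euclideanreal (\<lambda>x. Max ((\<lambda>i. f i x) ` I))"
  using assms
proof (induction I rule: finite_ne_induct)
  case (insert i I)
  then have "Max ((\<lambda>i. f i x) ` insert i I) = max (f i x) (Max ((\<lambda>i. f i x) ` I))" for x
    by simp
  with insert show ?case by (auto intro: continuous_map_real_max)
qed simp

lemma continuous_map_realI:
  fixes f :: "'a \<Rightarrow> real"
  assumes "\<And>x \<epsilon>. x \<in> topspace X \<Longrightarrow> 0 < \<epsilon> \<Longrightarrow>
    \<exists>U. openin X U \<and> x \<in> U \<and> (\<forall>y\<in>U. \<bar>f y - f x\<bar> < \<epsilon>)"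
  shows "continuous_map X euclideanreal f"
proof -
  have "\<forall>\<^sub>F y in atin X x. dist (f y) (f x) < \<epsilon>" if x: "x \<in> topspace X" and "0 < \<epsilon>" for x \<epsilon>
  proof -
    obtain U where "openin X U" "x \<in> U" "\<forall>y\<in>U. \<bar>f y - f x\<bar> < \<epsilon>"
      using assms[OF x \<open>0 < \<epsilon>\<close>] by blast
    then show ?thesis using x by (auto simp: eventually_atin dist_real_def)
  qed
  then show ?thesis
    by (auto simp: continuous_map_atin tendsto_iff)
qed

lemma openin_powertop_real_box:
  assumes "finite I"
  shows "openin (powertop_real I) (\<Pi>\<^sub>E i\<in>I. {y i - \<epsilon><..<y i + \<epsilon>})"
  by (auto simp: openin_PiE_gen assms)

text \<open>A real matrix with finitely many rows \<open>F i\<close> and columns indexed by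
  \<open>X\<close>; \<open>R\<close> is its row span. \<open>R_gen\<close> gives the form of this
  that the proofs use: at each point some translate of a row lies below \<open>f\<close> and touches
  it there. \<open>attained\<close> stands in for finiteness of \<open>X\<close>; for a curve it
  comes from compactness.\<close>

locale tropical_pairing =
  fixes X :: "'x set" and I :: "'i set" and F :: "'i \<Rightarrow> 'x \<Rightarrow> real" and R :: "('x \<Rightarrow> real) set"
    and K :: real
  assumes finite_I: "finite I" and I_ne: "I \<noteq> {}" and X_ne: "X \<noteq> {}"
    and bounded: "\<And>i x. i \<in> I \<Longrightarrow> x \<in> X \<Longrightarrow> \<bar>F i x\<bar> \<le> K"
    and R_ext: "R \<subseteq> extensional X"
    and R_gen: "\<And>f x. f \<in> R \<Longrightarrow> x \<in> X \<Longrightarrow>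
          \<exists>i\<in>I. \<exists>a. f x = a + F i x \<and> (\<forall>y\<in>X. a + F i y \<le> f y)"
    and combination_in_R: "\<And>y. (\<lambda>x\<in>X. Max ((\<lambda>i. F i x - y i) ` I)) \<in> R"
    and attained: "\<And>f i. f \<in> R \<Longrightarrow> i \<in> I \<Longrightarrow> \<exists>x\<in>X. \<forall>y\<in>X. F i y - f y \<le> F i x - f x"
begin

text \<open>\<open>T y \<le> f\<close> and \<open>S f \<le> y\<close> both mean
  \<open>F i x \<le> f x + y i\<close> for all \<open>i\<close> and \<open>x\<close>:
  \<open>T\<close> and \<open>S\<close> form an antitone Galois connection. One inequality in each
  of \<open>T_S\<close> and \<open>S_T\<close> is formal; the other uses membership in the
  span.\<close>

definition T :: "('i \<Rightarrow> real) \<Rightarrow> 'x \<Rightarrow> real" where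
  "T y = (\<lambda>x\<in>X. Max ((\<lambda>i. F i x - y i) ` I))"

definition S :: "('x \<Rightarrow> real) \<Rightarrow> 'i \<Rightarrow> real" where
  "S f = (\<lambda>i\<in>I. SUP x\<in>X. F i x - f x)"

text \<open>The column span, described by touching instead of by coefficients: in each coordinate a
  translate of some column meets \<open>y\<close> from below. As there are finitely many
  coordinates, one column for each of them gives a finite combination.\<close>

definition H :: "('i \<Rightarrow> real) set" where
  "H = {y \<in> extensional I. \<forall>i\<in>I. \<exists>x\<in>X. \<exists>c. y i = c + F i x \<and> (\<forall>j\<in>I. c + F j x \<le> y j)}"

lemma T_in_R: "T y \<in> R"
  unfolding T_def by (rule combination_in_R)

lemma T_ge: "i \<in> I \<Longrightarrow> x \<in> X \<Longrightarrow> F i x - y i \<le> T y x"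
  by (simp add: T_def finite_I)

lemma T_attained: "\<exists>i\<in>I. T y x = F i x - y i" if x: "x \<in> X"
proof -
  have "Max ((\<lambda>i. F i x - y i) ` I) \<in> (\<lambda>i. F i x - y i) ` I"
    using finite_I I_ne by (intro Max_in) auto
  then show ?thesis using x by (auto simp only: T_def restrict_apply')
qed

lemma T_le: "x \<in> X \<Longrightarrow> (\<And>i. i \<in> I \<Longrightarrow> F i x - y i \<le> b) \<Longrightarrow> T y x \<le> b"
  using T_attained by metis

lemma S_attained:
  assumes "f \<in> R" "i \<in> I"
  shows "\<exists>x\<in>X. S f i = F i x - f x \<and> (\<forall>y\<in>X. F i y - f y \<le> S f i)"
proof -
  obtain x where x: "x \<in> X" "\<forall>y\<in>X. F i y - f y \<le> F i x - f x"
    using attained[OF assms] by blast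
  then have "(SUP x\<in>X. F i x - f x) = F i x - f x"
    by (intro cSup_eq_maximum) auto
  then show ?thesis using x assms by (auto simp: S_def)
qed

lemma S_ge: "f \<in> R \<Longrightarrow> i \<in> I \<Longrightarrow> x \<in> X \<Longrightarrow> F i x - f x \<le> S f i"
  using S_attained by blast

lemma S_le: "f \<in> R \<Longrightarrow> i \<in> I \<Longrightarrow> (\<And>x. x \<in> X \<Longrightarrow> F i x - f x \<le> b) \<Longrightarrow> S f i \<le> b"
  using S_attained by metis

text \<open>The translate of row \<open>i\<close> that touches \<open>f\<close> at \<open>x\<close>
  bounds \<open>S f i\<close> from above, which forces \<open>T (S f)\<close> up to \<open>f\<close>
  at \<open>x\<close>.\<close>

lemma T_S:
  assumes f: "f \<in> R"
  shows "T (S f) = f"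
proof (rule extensionalityI)
  fix x assume x: "x \<in> X"
  have "T (S f) x \<le> f x"
    using S_ge[OF f _ x] by (intro T_le x) (simp add: algebra_simps)
  moreover obtain i a where i: "i \<in> I" "f x = a + F i x" "\<forall>y\<in>X. a + F i y \<le> f y"
    using R_gen[OF f x] by blast
  have "S f i \<le> - a" using i by (intro S_le f) (auto simp: algebra_simps)
  then have "f x \<le> T (S f) x"
    using T_ge[OF i(1) x, of "S f"] i(2) by linarith
  ultimately show "T (S f) x = f x" by simp
qed (use f R_ext in \<open>auto simp: T_def\<close>)

lemma S_in_H:
  assumes f: "f \<in> R"
  shows "S f \<in> H"
  unfolding H_def
proof safe
  fix i assume i: "i \<in> I"
  obtain x where "x \<in> X" "S f i = F i x - f x" using S_attained[OF f i] by blast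
  then show "\<exists>x\<in>X. \<exists>c. S f i = c + F i x \<and> (\<forall>j\<in>I. c + F j x \<le> S f j)"
    using S_ge[OF f] by (intro bexI[of _ x] exI[of _ "- f x"]) (auto simp: algebra_simps)
qed (simp add: S_def)

text \<open>The argument of \<open>T_S\<close> with rows and columns exchanged: a column touching
  \<open>y\<close> in coordinate \<open>i\<close> replaces the touching row.\<close>

lemma S_T:
  assumes y: "y \<in> H"
  shows "S (T y) = y"
proof (rule extensionalityI)
  fix i assume i: "i \<in> I"
  have "S (T y) i \<le> y i"
    using T_ge[OF i, of _ y] by (intro S_le T_in_R i) (simp add: algebra_simps)
  moreover obtain x c where x: "x \<in> X" "y i = c + F i x" "\<forall>j\<in>I. c + F j x \<le> y j"
    using y i unfolding H_def by blast
  have "T y x \<le> - c" using x by (intro T_le) (auto simp: algebra_simps)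
  then have "y i \<le> S (T y) i"
    using S_ge[OF T_in_R i x(1), of y] x(2) by linarith
  ultimately show "S (T y) i = y i" by simp
qed (use y in \<open>auto simp: S_def H_def\<close>)

lemma H_ext: "H \<subseteq> extensional I"
  by (auto simp: H_def)

lemma H_add_const:
  assumes y: "y \<in> H"
  shows "(\<lambda>i\<in>I. y i + c) \<in> H"
  unfolding H_def
proof safe
  fix i assume i: "i \<in> I"
  obtain x a where "x \<in> X" "y i = a + F i x" "\<forall>j\<in>I. a + F j x \<le> y j"
    using y i unfolding H_def by blast
  then show "\<exists>x\<in>X. \<exists>b. (\<lambda>i\<in>I. y i + c) i = b + F i x \<and> (\<forall>j\<in>I. b + F j x \<le> (\<lambda>i\<in>I. y i + c) j)"
    using i by (intro bexI[of _ x] exI[of _ "a + c"]) auto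
qed simp

lemma based_at_in_H: "y \<in> H \<Longrightarrow> based_at I i0 y \<in> H"
  using H_add_const[of y "- y i0"] by (simp add: based_at_def)

text \<open>The column that touches \<open>y\<close> in coordinate \<open>i\<close> bounds
  \<open>y j\<close> from below, so the difference is at most one between two entries of a single
  column.\<close>

lemma H_diff_le:
  assumes "y \<in> H" "i \<in> I" "j \<in> I"
  shows "y i - y j \<le> 2 * K"
proof -
  obtain x c where x: "x \<in> X" "y i = c + F i x" "\<forall>j\<in>I. c + F j x \<le> y j"
    using assms(1,2) unfolding H_def by blast
  then have "y i - y j \<le> F i x - F j x" using assms by auto
  then show ?thesis
    using bounded[OF assms(2) x(1)] bounded[OF assms(3) x(1)] by linarith
qed

lemma T_lipschitz:
  assumes "\<And>i. i \<in> I \<Longrightarrow> \<bar>y i - z i\<bar> \<le> \<delta>" "x \<in> X"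
  shows "T y x \<le> T z x + \<delta>"
proof (rule T_le[OF assms(2)])
  fix i assume i: "i \<in> I"
  show "F i x - y i \<le> T z x + \<delta>"
    using T_ge[OF i assms(2), of z] assms(1)[OF i] by linarith
qed

lemma S_T_lipschitz:
  assumes "\<And>i. i \<in> I \<Longrightarrow> \<bar>y i - z i\<bar> \<le> \<delta>" "i \<in> I"
  shows "S (T y) i \<le> S (T z) i + \<delta>"
proof (intro S_le T_in_R)
  fix x assume x: "x \<in> X"
  have "T z x \<le> T y x + \<delta>"
    using assms(1) by (intro T_lipschitz x) (simp add: abs_minus_commute)
  then show "F i x - T y x \<le> S (T z) i + \<delta>"
    using S_ge[OF T_in_R assms(2) x, of z] by linarith
qed (fact assms(2))

lemma continuous_map_T: "continuous_map (powertop_real I) (powertop_real X) T"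
  unfolding continuous_map_componentwise
proof safe
  fix x assume x: "x \<in> X"
  have "continuous_map (powertop_real I) euclideanreal (\<lambda>y. Max ((\<lambda>i. F i x - y i) ` I))"
    by (intro continuous_map_Max finite_I I_ne continuous_intros continuous_map_product_projection)
  then show "continuous_map (powertop_real I) euclideanreal (\<lambda>y. T y x)"
    using x by (simp add: T_def)
qed (simp add: T_def)

text \<open>\<open>S\<close> is a supremum over possibly infinitely many points, so its continuity
  under pointwise convergence is not evident. The composite is non-expansive in the maximum norm of
  the finitely many coordinates, so a box of half-width \<epsilon>/2 controls it.\<close>

lemma continuous_map_S_T: "continuous_map (powertop_real I) (powertop_real I) (\<lambda>y. S (T y))"
  unfolding continuous_map_componentwise
proof safe
  fix i assume i: "i \<in> I"
  show "continuous_map (powertop_real I) euclideanreal (\<lambda>y. S (T y) i)"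
  proof (rule continuous_map_realI)
    fix y and \<epsilon> :: real assume y: "y \<in> topspace (powertop_real I)" and \<epsilon>: "0 < \<epsilon>"
    let ?U = "\<Pi>\<^sub>E i\<in>I. {y i - \<epsilon>/2<..<y i + \<epsilon>/2}"
    have "\<bar>S (T z) i - S (T y) i\<bar> < \<epsilon>" if z: "z \<in> ?U" for z
    proof -
      have *: "\<bar>z i - y i\<bar> \<le> \<epsilon>/2" if "i \<in> I" for i
        using PiE_mem[OF z that] unfolding greaterThanLessThan_iff abs_le_iff by linarith
      then have "S (T z) i \<le> S (T y) i + \<epsilon>/2" "S (T y) i \<le> S (T z) i + \<epsilon>/2"
        using i by (auto intro!: S_T_lipschitz simp: abs_minus_commute)
      then show ?thesis using \<epsilon> by linarith
    qed
    then show "\<exists>U. openin (powertop_real I) U \<and> y \<in> U \<and> (\<forall>z\<in>U. \<bar>S (T z) i - S (T y) i\<bar> < \<epsilon>)"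
      using y \<epsilon> by (intro exI[of _ ?U]) (auto simp: openin_powertop_real_box[OF finite_I])
  qed
qed (simp add: S_def)

text \<open>No closedness proof is made: the normalised part of \<open>H\<close> lies in a cube and
  is fixed by \<open>S\<close> after \<open>T\<close> up to normalisation, so it is a continuous
  image of the whole cube.\<close>

lemma compactin_based_H:
  assumes i0: "i0 \<in> I"
  shows "compactin (powertop_real I) (based_at I i0 ` H)"
proof -
  \<comment> \<open>The half-width \<open>2*K\<close> is the bound of \<open>H_diff_le\<close>,
    applied to the pairs with the base coordinate \<open>i0\<close>.\<close>
  let ?Q = "\<Pi>\<^sub>E i\<in>I. {- (2*K)..2*K}"
  have "based_at I i0 ` H = based_at I i0 ` (\<lambda>y. S (T y)) ` ?Q"
  proof
    show "based_at I i0 ` (\<lambda>y. S (T y)) ` ?Q \<subseteq> based_at I i0 ` H"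
      using S_in_H[OF T_in_R] by blast
    show "based_at I i0 ` H \<subseteq> based_at I i0 ` (\<lambda>y. S (T y)) ` ?Q"
    proof
      fix z assume "z \<in> based_at I i0 ` H"
      then obtain y where y: "y \<in> H" "z = based_at I i0 y" by blast
      have "z \<in> ?Q"
      proof (rule PiE_I)
        fix i assume "i \<in> I"
        then show "z i \<in> {- (2*K)..2*K}"
          using H_diff_le[OF y(1) i0, of i] H_diff_le[OF y(1) _ i0, of i] y(2) by auto
      qed (use y(2) in \<open>simp add: extensional_arb[OF based_at_extensional]\<close>)
      moreover have "z = based_at I i0 (S (T z))"
        using based_at_in_H[OF y(1)] y i0 by (simp add: S_T)
      ultimately show "z \<in> based_at I i0 ` (\<lambda>y. S (T y)) ` ?Q" by blast
    qed
  qed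
  moreover have "compactin (powertop_real I) ?Q" by (simp add: compactin_PiE)
  ultimately show ?thesis
    by (metis image_compactin continuous_map_S_T continuous_map_based_at[OF i0])
qed

lemma T_add_const: "T (\<lambda>i\<in>I. y i + c) = (\<lambda>x\<in>X. T y x - c)"
proof (rule extensionalityI)
  fix x assume x: "x \<in> X"
  have "T (\<lambda>i\<in>I. y i + c) x \<le> T y x - c"
    using T_ge[OF _ x, of _ y] by (intro T_le x) (auto simp: algebra_simps)
  moreover have "T y x \<le> T (\<lambda>i\<in>I. y i + c) x + c"
    using T_ge[OF _ x, of _ "\<lambda>i\<in>I. y i + c"] by (intro T_le x) (force simp: algebra_simps)
  ultimately show "T (\<lambda>i\<in>I. y i + c) x = (\<lambda>x\<in>X. T y x - c) x" using x by simp
qed (auto simp: T_def)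

lemma S_add_const:
  assumes "(\<lambda>x\<in>X. f x + c) \<in> R" "f \<in> R"
  shows "S (\<lambda>x\<in>X. f x + c) = (\<lambda>i\<in>I. S f i - c)"
proof (rule extensionalityI)
  fix i assume i: "i \<in> I"
  have "S (\<lambda>x\<in>X. f x + c) i \<le> S f i - c"
    using S_ge[OF assms(2) i] by (intro S_le i assms) (auto simp: algebra_simps)
  moreover have "S f i \<le> S (\<lambda>x\<in>X. f x + c) i + c"
    using S_ge[OF assms(1) i] by (intro S_le i assms) (force simp: algebra_simps)
  ultimately show "S (\<lambda>x\<in>X. f x + c) i = (\<lambda>i\<in>I. S f i - c) i" using i by simp
qed (auto simp: S_def)

text \<open>A continuous bijection from a compact to a Hausdorff space. The normalisations on both
  sides are compatible because \<open>T\<close> and \<open>S\<close> turn an added constant into its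
  negative. If \<open>T y\<close> and \<open>T z\<close> differ by a constant, \<open>S\<close>
  recovers \<open>y\<close> and \<open>z\<close> up to a constant, and both are normalised.\<close>

theorem homeomorphic_map_based:
  assumes i0: "i0 \<in> I" and x0: "x0 \<in> X"
  shows "homeomorphic_map (subtopology (powertop_real I) (based_at I i0 ` H))
           (subtopology (powertop_real X) (based_at X x0 ` R)) (\<lambda>y. based_at X x0 (T y))"
proof (rule continuous_imp_homeomorphic_map)
  have H': "based_at I i0 ` H \<subseteq> extensional I" "based_at X x0 ` R \<subseteq> extensional X" by auto
  have ts: "topspace (powertop_real I) = extensional I" "topspace (powertop_real X) = extensional X"
    by (simp_all add: PiE_def)
  have img: "(\<lambda>y. based_at X x0 (T y)) ` based_at I i0 ` H = based_at X x0 ` R"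
  proof
    show "(\<lambda>y. based_at X x0 (T y)) ` based_at I i0 ` H \<subseteq> based_at X x0 ` R"
      using T_in_R by blast
    show "based_at X x0 ` R \<subseteq> (\<lambda>y. based_at X x0 (T y)) ` based_at I i0 ` H"
    proof safe
      fix f assume f: "f \<in> R"
      let ?y = "based_at I i0 (S f)"
      have "?y = (\<lambda>i\<in>I. S f i + - S f i0)" by (simp add: based_at_def)
      then have "T ?y = (\<lambda>x\<in>X. f x + S f i0)"
        by (simp only: T_add_const T_S[OF f]) (simp cong: restrict_cong)
      then have "based_at X x0 f = based_at X x0 (T ?y)" using x0 by simp
      then show "based_at X x0 f \<in> (\<lambda>y. based_at X x0 (T y)) ` based_at I i0 ` H"
        using S_in_H[OF f] by blast
    qed
  qed
  show "continuous_map (subtopology (powertop_real I) (based_at I i0 ` H))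
      (subtopology (powertop_real X) (based_at X x0 ` R)) (\<lambda>y. based_at X x0 (T y))"
    using img continuous_map_compose[OF continuous_map_T continuous_map_based_at[OF x0]]
    by (auto simp: continuous_map_in_subtopology continuous_map_from_subtopology o_def)
  show "compact_space (subtopology (powertop_real I) (based_at I i0 ` H))"
    by (intro compact_space_subtopology compactin_based_H i0)
  show "Hausdorff_space (subtopology (powertop_real X) (based_at X x0 ` R))"
    by (intro Hausdorff_space_subtopology) (simp add: Hausdorff_space_product_topology)
  show "(\<lambda>y. based_at X x0 (T y)) ` topspace (subtopology (powertop_real I) (based_at I i0 ` H)) =
      topspace (subtopology (powertop_real X) (based_at X x0 ` R))"
    using img H' unfolding topspace_subtopology ts by (simp add: Int_absorb1)
  show "inj_on (\<lambda>y. based_at X x0 (T y)) (topspace (subtopology (powertop_real I) (based_at I i0 ` H)))"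
  proof (rule inj_onI)
    fix y z
    assume "y \<in> topspace (subtopology (powertop_real I) (based_at I i0 ` H))"
      and "z \<in> topspace (subtopology (powertop_real I) (based_at I i0 ` H))"
      and eq: "based_at X x0 (T y) = based_at X x0 (T z)"
    then have yz: "y \<in> H" "z \<in> H" "based_at I i0 y = y" "based_at I i0 z = z"
      using based_at_in_H i0 by auto
    define c where "c = T y x0 - T z x0"
    have Ty: "T y = (\<lambda>x\<in>X. T z x + c)"
      unfolding c_def using T_in_R R_ext by (intro based_at_eqD eq) auto
    have "y = S (\<lambda>x\<in>X. T z x + c)" using S_T[OF yz(1)] Ty by simp
    also have "\<dots> = (\<lambda>i\<in>I. S (T z) i - c)"
      by (rule S_add_const) (use Ty T_in_R[of y] T_in_R in auto)
    also have "\<dots> = (\<lambda>i\<in>I. z i + - c)" by (simp add: S_T[OF yz(2)])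
    finally have "based_at I i0 y = based_at I i0 z" using i0 by (simp only: based_at_add_const)
    then show "y = z" using yz by simp
  qed
qed

lemma compact_space_based_R:
  assumes "x0 \<in> X"
  shows "compact_space (subtopology (powertop_real X) (based_at X x0 ` R))"
proof -
  obtain i0 where i0: "i0 \<in> I" using I_ne by blast
  have "subtopology (powertop_real I) (based_at I i0 ` H) homeomorphic_space
      subtopology (powertop_real X) (based_at X x0 ` R)"
    using homeomorphic_map_based[OF i0 assms] homeomorphic_map_imp_homeomorphic_space by blast
  then show ?thesis
    using homeomorphic_compact_space compact_space_subtopology[OF compactin_based_H[OF i0]] by blast
qed

end

section \<open>Piecewise affine functions of one variable\<close>

text \<open>One notion for the germs right of a point, left of a point and at infinity. Properness
  and avoidance of single points make the slope of a germ unique; the interval condition yields its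
  existence for functions that are affine between breakpoints.\<close>

definition one_sided :: "real filter \<Rightarrow> bool" where
  "one_sided F \<longleftrightarrow> F \<noteq> bot \<and> (\<forall>k. \<forall>\<^sub>F t in F. t \<noteq> k) \<and>
     (\<forall>P. eventually P F \<longrightarrow> (\<exists>I. is_interval I \<and> (\<forall>\<^sub>F t in F. t \<in> I) \<and> (\<forall>t\<in>I. P t)))"

lemma one_sidedD:
  assumes "one_sided F" "eventually P F"
  obtains I where "is_interval I" "\<forall>\<^sub>F t in F. t \<in> I" "\<And>t. t \<in> I \<Longrightarrow> P t"
  using assms unfolding one_sided_def by blast

lemma one_sided_at_right: "one_sided (at_right (a::real))"
  unfolding one_sided_def
proof (intro conjI allI impI)
  fix k show "\<forall>\<^sub>F t in at_right a. t \<noteq> k"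
    by (rule eventually_neq_at_within)
next
  fix P :: "real \<Rightarrow> bool" assume "eventually P (at_right a)"
  then obtain b where b: "b > a" "\<And>y. y > a \<Longrightarrow> y < b \<Longrightarrow> P y"
    unfolding eventually_at_right_field by blast
  then show "\<exists>I. is_interval I \<and> (\<forall>\<^sub>F t in at_right a. t \<in> I) \<and> (\<forall>t\<in>I. P t)"
    by (intro exI[of _ "{a<..<b}"]) (auto simp: is_interval_1 eventually_at_right_field)
qed simp

lemma one_sided_at_left: "one_sided (at_left (a::real))"
  unfolding one_sided_def
proof (intro conjI allI impI)
  fix k show "\<forall>\<^sub>F t in at_left a. t \<noteq> k"
    by (rule eventually_neq_at_within)
next
  fix P :: "real \<Rightarrow> bool" assume "eventually P (at_left a)"
  then obtain b where b: "b < a" "\<And>y. y > b \<Longrightarrow> y < a \<Longrightarrow> P y"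
    unfolding eventually_at_left_field by blast
  then show "\<exists>I. is_interval I \<and> (\<forall>\<^sub>F t in at_left a. t \<in> I) \<and> (\<forall>t\<in>I. P t)"
    by (intro exI[of _ "{b<..<a}"]) (auto simp: is_interval_1 eventually_at_left_field)
qed simp

lemma one_sided_at_top: "one_sided (at_top :: real filter)"
  unfolding one_sided_def
proof (intro conjI allI impI)
  fix k :: real show "\<forall>\<^sub>F t in at_top. t \<noteq> k"
    using eventually_gt_at_top[of k] by eventually_elim simp
next
  fix P :: "real \<Rightarrow> bool" assume "eventually P at_top"
  then obtain N where "\<And>t. t \<ge> N \<Longrightarrow> P t" unfolding eventually_at_top_linorder by blast
  then show "\<exists>I. is_interval I \<and> (\<forall>\<^sub>F t in at_top. t \<in> I) \<and> (\<forall>t\<in>I. P t)"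
    by (intro exI[of _ "{N..}"]) (auto simp: is_interval_1 eventually_at_top_linorder)
qed simp

section \<open>Integer slopes of germs\<close>

definition has_slope :: "(real \<Rightarrow> real) \<Rightarrow> real filter \<Rightarrow> int \<Rightarrow> bool" where
  "has_slope h F m \<longleftrightarrow> (\<exists>c. \<forall>\<^sub>F t in F. h t = of_int m * t + c)"

definition slope :: "(real \<Rightarrow> real) \<Rightarrow> real filter \<Rightarrow> int" where
  "slope h F = (THE m. has_slope h F m)"

lemma has_slope_unique:
  assumes F: "one_sided F" and "has_slope h F m" "has_slope h F n"
  shows "m = n"
proof (rule ccontr)
  assume ne: "m \<noteq> n"
  obtain c d where c: "\<forall>\<^sub>F t in F. h t = of_int m * t + c" and d: "\<forall>\<^sub>F t in F. h t = of_int n * t + d"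
    using assms(2,3) unfolding has_slope_def by blast
  \<comment> \<open>The excluded value is the only parameter where the two lines meet.\<close>
  have "\<forall>\<^sub>F t in F. t \<noteq> (d - c) / of_int (m - n)" using F unfolding one_sided_def by blast
  with c d have "\<forall>\<^sub>F t in F. False"
    by eventually_elim (use ne in \<open>simp add: field_simps\<close>)
  then show False using F by (simp add: one_sided_def)
qed

lemma slopeI: "one_sided F \<Longrightarrow> has_slope h F m \<Longrightarrow> slope h F = m"
  unfolding slope_def by (blast intro: has_slope_unique)

lemma has_slope_cong:
  assumes "\<forall>\<^sub>F t in F. h t = g t"
  shows "has_slope h F m \<longleftrightarrow> has_slope g F m"
proof -
  have "(\<forall>\<^sub>F t in F. h t = of_int m * t + c) \<longleftrightarrow> (\<forall>\<^sub>F t in F. g t = of_int m * t + c)" for c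
    using assms by (intro eventually_subst) (auto elim: eventually_mono)
  then show ?thesis unfolding has_slope_def by simp
qed

lemma has_slope_diff:
  assumes "has_slope h F m" "has_slope g F n"
  shows "has_slope (\<lambda>t. h t - g t) F (m - n)"
proof -
  obtain c d where "\<forall>\<^sub>F t in F. h t = of_int m * t + c" "\<forall>\<^sub>F t in F. g t = of_int n * t + d"
    using assms unfolding has_slope_def by blast
  then have "\<forall>\<^sub>F t in F. h t - g t = of_int (m - n) * t + (c - d)"
    by eventually_elim (simp add: algebra_simps)
  then show ?thesis unfolding has_slope_def by blast
qed

lemma has_slope_add_const:
  assumes "has_slope h F m"
  shows "has_slope (\<lambda>t. a + h t) F m"
proof -
  obtain c where "\<forall>\<^sub>F t in F. h t = of_int m * t + c"
    using assms unfolding has_slope_def by blast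
  then have "\<forall>\<^sub>F t in F. a + h t = of_int m * t + (a + c)"
    by eventually_elim simp
  then show ?thesis unfolding has_slope_def by blast
qed

lemma has_slope_affine:
  "(\<And>t. t \<in> A \<Longrightarrow> h t = of_int m * t + c) \<Longrightarrow> \<forall>\<^sub>F t in F. t \<in> A \<Longrightarrow> has_slope h F m"
  unfolding has_slope_def by (blast intro: eventually_mono)

lemma has_slope_at_within_limit:
  assumes "has_slope h (at a within A) m" "(h \<longlongrightarrow> v) (at a within A)" "at a within A \<noteq> bot"
  shows "\<forall>\<^sub>F t in at a within A. h t = v + of_int m * (t - a)"
proof -
  obtain c where c: "\<forall>\<^sub>F t in at a within A. h t = of_int m * t + c"
    using assms unfolding has_slope_def by blast
  have "((\<lambda>t. of_int m * t + c) \<longlongrightarrow> of_int m * a + c) (at a within A)"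
    by (intro tendsto_intros)
  then have "(h \<longlongrightarrow> of_int m * a + c) (at a within A)"
    using c by (simp cong: tendsto_cong)
  then have "v = of_int m * a + c" using assms tendsto_unique by blast
  with c show ?thesis by (auto elim!: eventually_mono simp: algebra_simps)
qed

text \<open>A nonzero integer slope has absolute value at least 1, so the function would leave every
  bounded set. This is why a rational function, having a real limit at a point at infinity, is
  eventually constant on an infinite edge.\<close>

lemma has_slope_at_top_limit:
  assumes "has_slope h at_top m" "(h \<longlongrightarrow> v) at_top"
  shows "m = 0"
proof (rule ccontr)
  assume m: "m \<noteq> 0"
  obtain c where c: "\<forall>\<^sub>F t in at_top. h t = of_int m * t + c"
    using assms unfolding has_slope_def by blast
  have "\<forall>\<^sub>F t in at_top. \<bar>h t - v\<bar> < 1"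
    using tendstoD[OF assms(2), of 1] by (simp add: dist_real_def)
  \<comment> \<open>Closeness to \<open>v\<close> gives |m t| < 1 + |v - c|, while |m| \<ge> 1 makes
    |m t| at least \<open>t\<close>.\<close>
  moreover have "\<forall>\<^sub>F t in at_top. t > 1 + \<bar>v - c\<bar>" by (rule eventually_gt_at_top)
  ultimately have "\<forall>\<^sub>F t::real in at_top. False" using c
  proof eventually_elim
    case (elim t)
    have "1 \<le> \<bar>real_of_int m\<bar>" using m by (simp flip: of_int_abs)
    then have "t \<le> \<bar>of_int m\<bar> * t"
      using elim mult_right_mono[of 1 "\<bar>real_of_int m\<bar>" t] by simp
    also have "\<dots> = \<bar>of_int m * t\<bar>" using elim by (simp add: abs_mult)
    also have "\<dots> < 1 + \<bar>v - c\<bar>" using elim by linarith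
    finally show False using elim by linarith
  qed
  then show False by simp
qed

lemma slope_mono_at_right:
  assumes f: "has_slope f (at_right a) m" "(f \<longlongrightarrow> v) (at_right a)"
    and h: "has_slope h (at_right a) n" "(h \<longlongrightarrow> v) (at_right a)"
    and le: "\<forall>\<^sub>F t in at_right a. f t \<le> h t"
  shows "m \<le> n"
proof -
  have "\<forall>\<^sub>F t in at_right a. a < t" by (simp add: eventually_at_filter)
  with has_slope_at_within_limit[OF f trivial_limit_at_right_real]
    has_slope_at_within_limit[OF h trivial_limit_at_right_real] le
  have "\<forall>\<^sub>F t in at_right a. m \<le> n"
    by eventually_elim (simp add: mult_le_cancel_right)
  then show ?thesis by simp
qed

lemma slope_mono_at_left:
  assumes f: "has_slope f (at_left a) m" "(f \<longlongrightarrow> v) (at_left a)"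
    and h: "has_slope h (at_left a) n" "(h \<longlongrightarrow> v) (at_left a)"
    and le: "\<forall>\<^sub>F t in at_left a. f t \<le> h t"
  shows "n \<le> m"
proof -
  have "\<forall>\<^sub>F t in at_left a. t < a" by (simp add: eventually_at_filter)
  with has_slope_at_within_limit[OF f trivial_limit_at_left_real]
    has_slope_at_within_limit[OF h trivial_limit_at_left_real] le
  have "\<forall>\<^sub>F t in at_left a. n \<le> m"
    by eventually_elim (simp add: mult_le_cancel_right)
  then show ?thesis by simp
qed

section \<open>Functions affine off a finite set, and their maxima\<close>

definition affine_off :: "real set \<Rightarrow> real set \<Rightarrow> (real \<Rightarrow> real) \<Rightarrow> bool" where
  "affine_off U B h \<longleftrightarrow> (\<forall>I. is_interval I \<and> I \<subseteq> U - B \<longrightarrow>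
     (\<exists>(m::int) c. \<forall>t\<in>I. h t = of_int m * t + c))"

lemma affine_offD:
  assumes "affine_off U B h" "is_interval I" "I \<subseteq> U - B"
  obtains m :: int and c where "\<And>t. t \<in> I \<Longrightarrow> h t = of_int m * t + c"
  using assms unfolding affine_off_def by meson

lemma affine_off_mono: "affine_off U B h \<Longrightarrow> U' - B' \<subseteq> U - B \<Longrightarrow> affine_off U' B' h"
  unfolding affine_off_def by (meson order_trans)

lemma affine_off_diff:
  assumes "affine_off U B h" "affine_off U C g"
  shows "affine_off U (B \<union> C) (\<lambda>t. h t - g t)"
  unfolding affine_off_def
proof (intro allI impI)
  fix I assume I: "is_interval I \<and> I \<subseteq> U - (B \<union> C)"
  obtain m c where h: "\<And>t. t \<in> I \<Longrightarrow> h t = of_int m * t + c"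
    using I by (elim conjE) (rule affine_offD[OF assms(1)], auto)
  obtain n d where g: "\<And>t. t \<in> I \<Longrightarrow> g t = of_int n * t + d"
    using I by (elim conjE) (rule affine_offD[OF assms(2)], auto)
  show "\<exists>(m::int) c. \<forall>t\<in>I. h t - g t = of_int m * t + c"
    by (intro exI[of _ "m - n"] exI[of _ "c - d"]) (simp add: h g algebra_simps)
qed

lemma affine_off_add_const:
  assumes "affine_off U B h"
  shows "affine_off U B (\<lambda>t. a + h t)"
  unfolding affine_off_def
proof (intro allI impI)
  fix I assume I: "is_interval I \<and> I \<subseteq> U - B"
  obtain m c where h: "\<And>t. t \<in> I \<Longrightarrow> h t = of_int m * t + c"
    using I by (elim conjE) (rule affine_offD[OF assms], auto)
  show "\<exists>(m::int) c. \<forall>t\<in>I. a + h t = of_int m * t + c"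
    by (intro exI[of _ m] exI[of _ "a + c"]) (simp add: h)
qed

text \<open>Two transversal crossings are separated by a breakpoint, so a crossing \<open>t\<close> is determined
  by the set of breakpoints below it.\<close>

lemma affine_off_max:
  assumes U: "is_interval U" and B: "finite B" and f: "affine_off U B f" and g: "affine_off U B g"
  shows "\<exists>C. finite C \<and> affine_off U C (\<lambda>t. max (f t) (g t))"
proof -
  \<comment> \<open>Where \<open>f\<close> and \<open>g\<close> coincide on a whole interval the
    maximum does not bend; only transversal crossings are collected.\<close>
  define C where "C = {t \<in> U - B. f t = g t \<and>
    (\<exists>I. is_interval I \<and> I \<subseteq> U - B \<and> t \<in> I \<and> (\<exists>s\<in>I. f s \<noteq> g s))}"
  have affine_eq: "f s = g s"
    if I: "is_interval I" "I \<subseteq> U - B" and "u \<in> I" "v \<in> I" "u \<noteq> v" "f u = g u" "f v = g v" "s \<in> I"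
    for I u v s
  proof -
    obtain m c where m: "\<And>t. t \<in> I \<Longrightarrow> f t = of_int m * t + c"
      using affine_offD[OF f I] by metis
    obtain n d where n: "\<And>t. t \<in> I \<Longrightarrow> g t = of_int n * t + d"
      using affine_offD[OF g I] by metis
    have e: "of_int (m - n) * u = d - c" "of_int (m - n) * v = d - c"
      using that m[of u] n[of u] m[of v] n[of v] by (simp_all add: algebra_simps)
    then have "of_int (m - n) * (u - v) = (0::real)" by (simp add: algebra_simps)
    then have "m = n" using \<open>u \<noteq> v\<close> by simp
    then show ?thesis using e(1) m[OF \<open>s \<in> I\<close>] n[OF \<open>s \<in> I\<close>] by simp
  qed
  have "t = t'" if "t \<in> C" "t' \<in> C" "B \<inter> {..<t} = B \<inter> {..<t'}" "t \<le> t'" for t t'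
  proof (rule ccontr)
    assume "t \<noteq> t'"
    have t: "t \<in> U - B" "t' \<in> U - B" "f t = g t" "f t' = g t'" using that unfolding C_def by auto
    have "\<exists>I. is_interval I \<and> I \<subseteq> U - B \<and> t \<in> I \<and> (\<exists>s\<in>I. f s \<noteq> g s)"
      using that(1) by (simp add: C_def)
    then obtain I s where I: "is_interval I" "I \<subseteq> U - B" "t \<in> I" "s \<in> I" "f s \<noteq> g s"
      by auto
    \<comment> \<open>With no breakpoint between \<open>t\<close> and \<open>t'\<close>, the
      interval \<open>I\<close> extends to one that contains both crossings. Two zeros of an affine
      difference force \<open>f s = g s\<close>.\<close>
    let ?J = "I \<union> {t..t'}"
    have "x \<notin> B" if "x \<in> {t..t'}" for x
    proof
      assume "x \<in> B"
      then have "x < t'" using that t by (cases "x = t'") auto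
      then have "x \<in> B \<inter> {..<t}" using \<open>x \<in> B\<close> \<open>B \<inter> {..<t} = B \<inter> {..<t'}\<close> by blast
      then show False using that by simp
    qed
    moreover have "{t..t'} \<subseteq> U" using t U unfolding is_interval_1 by auto
    ultimately have "?J \<subseteq> U - B" using I by blast
    moreover have "is_interval ?J"
      unfolding is_interval_connected_1
      by (rule connected_Un) (use I(1,3) \<open>t \<le> t'\<close> in \<open>auto simp: is_interval_connected_1\<close>)
    ultimately show False
      using affine_eq[of ?J t t' s] t I \<open>t \<noteq> t'\<close> \<open>t \<le> t'\<close> by auto
  qed
  then have "inj_on (\<lambda>t. B \<inter> {..<t}) C"
    by (metis (no_types, lifting) inj_onI nle_le)
  moreover have "(\<lambda>t. B \<inter> {..<t}) ` C \<subseteq> Pow B" by auto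
  ultimately have "finite C" using B by (meson finite_Pow_iff inj_on_finite)
  moreover have "affine_off U (B \<union> C) (\<lambda>t. max (f t) (g t))"
    unfolding affine_off_def
  proof (intro allI impI)
    fix I assume "is_interval I \<and> I \<subseteq> U - (B \<union> C)"
    then have I: "is_interval I" "I \<subseteq> U - B" and IC: "I \<inter> C = {}" by auto
    obtain m c where m: "\<And>t. t \<in> I \<Longrightarrow> f t = of_int m * t + c"
      using affine_offD[OF f I] by metis
    obtain n d where n: "\<And>t. t \<in> I \<Longrightarrow> g t = of_int n * t + d"
      using affine_offD[OF g I] by metis
    \<comment> \<open>Off \<open>C\<close> the difference either vanishes on all of \<open>I\<close>
      or has no zero there; in the second case connectedness fixes its sign.\<close>
    have "(\<forall>t\<in>I. f t \<le> g t) \<or> (\<forall>t\<in>I. g t \<le> f t)"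
    proof (cases "\<exists>t\<in>I. f t = g t")
      case True
      then obtain t where t: "t \<in> I" "f t = g t" by blast
      then have "t \<notin> C" "t \<in> U - B" using I IC by auto
      then have "\<forall>s\<in>I. f s = g s" unfolding C_def using t I by blast
      then show ?thesis by simp
    next
      case False
      have cont: "continuous_on I (\<lambda>t. f t - g t)"
      proof -
        have "continuous_on I (\<lambda>t. (of_int m * t + c) - (of_int n * t + d))"
          by (intro continuous_intros)
        then show ?thesis by (rule continuous_on_eq) (simp add: m n)
      qed
      have "connected ((\<lambda>t. f t - g t) ` I)"
        using I(1) by (intro connected_continuous_image cont) (simp add: is_interval_connected_1)
      moreover have "0 \<notin> (\<lambda>t. f t - g t) ` I" using False by auto
      ultimately have "\<not> (f s - g s \<le> 0 \<and> 0 \<le> f u - g u)" if "s \<in> I" "u \<in> I" for s u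
        using connectedD_interval[of "(\<lambda>t. f t - g t) ` I" "f s - g s" "f u - g u" 0] that by blast
      then show ?thesis by (meson diff_ge_0_iff_ge diff_le_0_iff_le nle_le)
    qed
    then show "\<exists>(m::int) c. \<forall>t\<in>I. max (f t) (g t) = of_int m * t + c"
    proof
      assume "\<forall>t\<in>I. f t \<le> g t" then show ?thesis using n by (metis max.absorb2)
    next
      assume "\<forall>t\<in>I. g t \<le> f t" then show ?thesis using m by (metis max.absorb1)
    qed
  qed
  ultimately show ?thesis using B by (meson finite_UnI)
qed

lemma eventually_avoid_finite:
  assumes "one_sided F" "finite B" "\<forall>\<^sub>F t in F. t \<in> U"
  shows "\<forall>\<^sub>F t in F. t \<in> U - B"
proof -
  have "\<forall>b\<in>B. \<forall>\<^sub>F t in F. t \<noteq> b" using assms unfolding one_sided_def by blast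
  then have "\<forall>\<^sub>F t in F. \<forall>b\<in>B. t \<noteq> b" using assms by (simp add: eventually_ball_finite)
  with assms(3) show ?thesis by eventually_elim auto
qed

lemma affine_off_has_slope:
  assumes h: "affine_off U B h" and F: "one_sided F" "finite B" "\<forall>\<^sub>F t in F. t \<in> U"
  shows "has_slope h F (slope h F)"
proof -
  obtain I where I: "is_interval I" "\<forall>\<^sub>F t in F. t \<in> I" "\<And>t. t \<in> I \<Longrightarrow> t \<in> U - B"
    using one_sidedD[OF F(1) eventually_avoid_finite[OF F]] by blast
  obtain m c where "\<And>t. t \<in> I \<Longrightarrow> h t = of_int m * t + c"
    using affine_offD[OF h I(1)] I(3) by (metis subsetI)
  then have "has_slope h F m" using I(2) by (rule has_slope_affine)
  then show ?thesis using slopeI[OF F(1)] by simp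
qed

section \<open>Kinks as point masses of the second derivative, and Green's formula on an
  interval\<close>

definition kink :: "(real \<Rightarrow> real) \<Rightarrow> real \<Rightarrow> int" where
  "kink h t = slope h (at_right t) - slope h (at_left t)"

lemma eventually_in_open_at:
  assumes "open U" "(t::real) \<in> U"
  shows "\<forall>\<^sub>F s in at_right t. s \<in> U" "\<forall>\<^sub>F s in at_left t. s \<in> U"
proof -
  have "\<forall>\<^sub>F s in nhds t. s \<in> U" using assms by (auto simp: eventually_nhds)
  then show "\<forall>\<^sub>F s in at_right t. s \<in> U" "\<forall>\<^sub>F s in at_left t. s \<in> U"
    by (auto simp: eventually_at_filter elim: eventually_mono)
qed

lemma kink_eq_0:
  assumes h: "affine_off U B h" and "finite B" "open U" "t \<in> U" "t \<notin> B"
  shows "kink h t = 0"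
proof -
  have "open (U - B)" using assms by (simp add: finite_imp_closed open_Diff)
  then obtain e where e: "e > 0" "ball t e \<subseteq> U - B"
    using assms open_contains_ball by (metis DiffI)
  have "is_interval (ball t e)" by (simp add: is_interval_ball_real)
  then obtain m c where m: "\<And>s. s \<in> ball t e \<Longrightarrow> h s = of_int m * s + c"
    using affine_offD[OF h] e by metis
  have "t \<in> ball t e" using e by simp
  then have "has_slope h (at_right t) m" "has_slope h (at_left t) m"
    using eventually_in_open_at[of "ball t e" t] has_slope_affine[of "ball t e" h m c] m by blast+
  then have "slope h (at_right t) = m" "slope h (at_left t) = m"
    by (auto intro!: slopeI one_sided_at_right one_sided_at_left)
  then show ?thesis by (simp add: kink_def)
qed

lemma green_affine_piece:
  assumes ab: "a < b" and h: "affine_off {a<..<b} {} h"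
    and ha: "(h \<longlongrightarrow> ha) (at_right a)" and hb: "(h \<longlongrightarrow> hb) (at_left b)"
  shows "slope h (at_left b) = slope h (at_right a)"
    and "hb - ha = of_int (slope h (at_right a)) * (b - a)"
proof -
  have "is_interval {a<..<b}" by (auto simp: is_interval_1)
  then obtain m c where m: "\<And>t. t \<in> {a<..<b} \<Longrightarrow> h t = of_int m * t + c"
    using affine_offD[OF h, of "{a<..<b}"] by auto
  have ev: "\<forall>\<^sub>F t in at_right a. t \<in> {a<..<b}" "\<forall>\<^sub>F t in at_left b. t \<in> {a<..<b}"
    using ab by (auto simp: eventually_at_right_field eventually_at_left_field)
  have "has_slope h (at_right a) m" "has_slope h (at_left b) m"
    using ev has_slope_affine[of "{a<..<b}" h m c] m by blast+
  then have s: "slope h (at_right a) = m" "slope h (at_left b) = m"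
    by (auto intro!: slopeI one_sided_at_right one_sided_at_left)
  then show "slope h (at_left b) = slope h (at_right a)" by simp
  have "(h \<longlongrightarrow> of_int m * a + c) (at_right a)"
    by (rule Lim_transform_eventually[where f = "\<lambda>t. of_int m * t + c"])
       (use ev(1) m in \<open>auto intro!: tendsto_intros elim!: eventually_mono\<close>)
  then have "ha = of_int m * a + c" using ha tendsto_unique trivial_limit_at_right_real by blast
  moreover have "(h \<longlongrightarrow> of_int m * b + c) (at_left b)"
    by (rule Lim_transform_eventually[where f = "\<lambda>t. of_int m * t + c"])
       (use ev(2) m in \<open>auto intro!: tendsto_intros elim!: eventually_mono\<close>)
  then have "hb = of_int m * b + c" using hb tendsto_unique trivial_limit_at_left_real by blast
  ultimately show "hb - ha = of_int (slope h (at_right a)) * (b - a)"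
    using s by (simp add: algebra_simps)
qed

lemma continuous_on_open_one_sided:
  assumes "continuous_on U h" "open U" "(t::real) \<in> U"
  shows "(h \<longlongrightarrow> h t) (at_right t)" "(h \<longlongrightarrow> h t) (at_left t)"
proof -
  have "h \<midarrow>t\<rightarrow> h t"
    using assms by (simp add: continuous_on_eq_continuous_at isCont_def)
  then show "(h \<longlongrightarrow> h t) (at_right t)" "(h \<longlongrightarrow> h t) (at_left t)"
    by (simp_all add: tendsto_within_subset[of _ _ _ UNIV])
qed

text \<open>Twofold summation by parts of the second derivative of \<open>h\<close> against an affine function.\<close>

lemma green_interval:
  fixes h :: "real \<Rightarrow> real"
  assumes "finite B" "B \<subseteq> {a<..<b}" "a < b" "continuous_on {a<..<b} h"
    and "(h \<longlongrightarrow> ha) (at_right a)" "(h \<longlongrightarrow> hb) (at_left b)" "affine_off {a<..<b} B h"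
  shows "(\<Sum>t\<in>B. of_int (kink h t) * (\<alpha> * t + \<beta>)) =
    of_int (slope h (at_left b)) * (\<alpha> * b + \<beta>) - of_int (slope h (at_right a)) * (\<alpha> * a + \<beta>)
      - \<alpha> * (hb - ha)"
  using assms
\<comment> \<open>The largest breakpoint \<open>c\<close> is removed, so the right end has to vary:
  the formula left of \<open>c\<close> and the affine piece right of \<open>c\<close> are joined by
  the kink at \<open>c\<close>.\<close>
proof (induction B arbitrary: b hb rule: finite_linorder_max_induct)
  case empty
  have "slope h (at_left b) = slope h (at_right a)"
    and "hb = ha + of_int (slope h (at_right a)) * (b - a)"
    using green_affine_piece[of a b h ha hb] empty by simp_all
  note piece = this
  show ?case unfolding piece by (simp add: algebra_simps)
next
  case (insert c B)
  have c: "a < c" "c < b" and "c \<notin> B" using insert by auto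
  have lim: "(h \<longlongrightarrow> h c) (at_right c)" "(h \<longlongrightarrow> h c) (at_left c)"
    using continuous_on_open_one_sided[OF insert.prems(3)] c by auto
  have IH: "(\<Sum>t\<in>B. of_int (kink h t) * (\<alpha> * t + \<beta>)) =
    of_int (slope h (at_left c)) * (\<alpha> * c + \<beta>) - of_int (slope h (at_right a)) * (\<alpha> * a + \<beta>)
      - \<alpha> * (h c - ha)"
  proof (rule insert.IH)
    show "continuous_on {a<..<c} h" using insert.prems(3) c by (auto intro: continuous_on_subset)
    show "affine_off {a<..<c} B h" using insert.prems(6) c by (auto intro: affine_off_mono)
  qed (use insert c lim in auto)
  have "affine_off {c<..<b} {} h"
    by (rule affine_off_mono[OF insert.prems(6)]) (use insert.hyps c in force)
  from green_affine_piece[OF c(2) this lim(1) insert.prems(5)]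
  have piece: "slope h (at_left b) = slope h (at_right c)"
    and hb: "hb = h c + of_int (slope h (at_right c)) * (b - c)"
    by simp_all
  show ?case
    unfolding sum.insert[OF insert.hyps(1) \<open>c \<notin> B\<close>] IH piece hb
    by (simp add: kink_def algebra_simps)
qed

section \<open>Ramps, and Green's formula along a whole edge, finite or infinite\<close>

definition ramp :: "real \<Rightarrow> real \<Rightarrow> real \<Rightarrow> real" where
  "ramp a b t = max 0 (min 1 ((t - a) / (b - a)))"

lemma ramp_le [simp]: "a < b \<Longrightarrow> t \<le> a \<Longrightarrow> ramp a b t = 0"
  by (simp add: ramp_def min_def divide_nonpos_pos)

lemma ramp_ge [simp]: "a < b \<Longrightarrow> b \<le> t \<Longrightarrow> ramp a b t = 1"
  by (simp add: ramp_def min_absorb1)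

lemma ramp_between: "a < b \<Longrightarrow> a \<le> t \<Longrightarrow> t \<le> b \<Longrightarrow> ramp a b t = (t - a) / (b - a)"
  by (simp add: ramp_def)

lemma continuous_on_ramp: "a < b \<Longrightarrow> continuous_on A (ramp a b)"
  unfolding ramp_def by (intro continuous_intros) auto

lemma one_sided_nontrivial: "one_sided F \<Longrightarrow> F \<noteq> bot"
  by (simp add: one_sided_def)

text \<open>Treats the parameter intervals of finite and infinite edges alike. \<open>S\<close> and
  \<open>E\<close> are the filters at the start and the end of \<open>U\<close>; on an infinite edge
  \<open>E\<close> is \<open>at_top\<close>, so the end is accessible only through a filter.\<close>

locale open_edge =
  fixes U :: "real set" and S E :: "real filter"
  assumes open_U: "open U" and interval_U: "is_interval U" and U_ne: "U \<noteq> {}"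
    and S: "one_sided S" and E: "one_sided E"
    and eventually_S: "\<And>s. s \<in> U \<Longrightarrow> \<forall>\<^sub>F t in S. t \<in> U \<and> t < s"
    and eventually_E: "\<And>s. s \<in> U \<Longrightarrow> \<forall>\<^sub>F t in E. t \<in> U \<and> s < t"
begin

lemma between_in_U: "a \<in> U \<Longrightarrow> b \<in> U \<Longrightarrow> a \<le> t \<Longrightarrow> t \<le> b \<Longrightarrow> t \<in> U"
  using interval_U unfolding is_interval_1 by blast

lemma eventually_in_U: "\<forall>\<^sub>F t in S. t \<in> U" "\<forall>\<^sub>F t in E. t \<in> U"
  using U_ne eventually_S eventually_E by (auto simp: eventually_conj_iff)

lemma ex_below:
  assumes "finite A"
  shows "\<exists>s\<in>U. \<forall>t\<in>A \<inter> U. s < t"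
proof -
  have "\<forall>t\<in>A \<inter> U. \<forall>\<^sub>F s in S. s < t" using eventually_S by (auto simp: eventually_conj_iff)
  then have "\<forall>\<^sub>F s in S. \<forall>t\<in>A \<inter> U. s < t" using assms by (simp add: eventually_ball_finite)
  then have "\<forall>\<^sub>F s in S. s \<in> U \<and> (\<forall>t\<in>A \<inter> U. s < t)"
    using eventually_in_U(1) by eventually_elim auto
  then show ?thesis using eventually_happens'[OF one_sided_nontrivial[OF S]] by fast
qed

lemma ex_above:
  assumes "finite A"
  shows "\<exists>s\<in>U. \<forall>t\<in>A \<inter> U. t < s"
proof -
  have "\<forall>t\<in>A \<inter> U. \<forall>\<^sub>F s in E. t < s" using eventually_E by (auto simp: eventually_conj_iff)
  then have "\<forall>\<^sub>F s in E. \<forall>t\<in>A \<inter> U. t < s" using assms by (simp add: eventually_ball_finite)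
  then have "\<forall>\<^sub>F s in E. s \<in> U \<and> (\<forall>t\<in>A \<inter> U. t < s)"
    using eventually_in_U(2) by eventually_elim auto
  then show ?thesis using eventually_happens'[OF one_sided_nontrivial[OF E]] by fast
qed

context
  fixes h :: "real \<Rightarrow> real" and B :: "real set"
  assumes B: "finite B" "B \<subseteq> U" and h: "affine_off U B h" "continuous_on U h"
begin

lemma sum_kink_between:
  assumes "a \<in> U" "b \<in> U" "a < b"
  shows "(\<Sum>t\<in>B \<inter> {a<..<b}. of_int (kink h t) * (\<alpha> * t + \<beta>)) =
    of_int (slope h (at_left b)) * (\<alpha> * b + \<beta>) - of_int (slope h (at_right a)) * (\<alpha> * a + \<beta>)
      - \<alpha> * (h b - h a)"
proof (rule green_interval)
  have sub: "{a<..<b} \<subseteq> U" using between_in_U[OF assms(1,2)] by auto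
  show "continuous_on {a<..<b} h" using h sub continuous_on_subset by blast
  show "affine_off {a<..<b} (B \<inter> {a<..<b}) h"
    by (rule affine_off_mono[OF h(1)]) (use sub in auto)
qed (use B assms continuous_on_open_one_sided[OF h(2) open_U] in auto)

text \<open>Past all breakpoints there is a single affine piece up to the end. Since
  \<open>at_left a\<close> looks to the left of \<open>a\<close>, this piece must begin at some
  \<open>s\<close> strictly before \<open>a\<close> that still lies beyond \<open>B\<close>.\<close>

lemma slope_end:
  assumes "a \<in> U" "\<forall>t\<in>B. t < a"
  shows "slope h E = slope h (at_left a)"
proof -
  obtain s where s: "s \<in> U" "s < a" "\<forall>t\<in>B. t < s"
  proof -
    have "open (U \<inter> (\<Inter>t\<in>B. {t<..}))" using open_U B(1) by (intro open_Int open_INT) auto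
    moreover have "a \<in> U \<inter> (\<Inter>t\<in>B. {t<..})" using assms by auto
    ultimately have "\<forall>\<^sub>F s in at_left a. s \<in> U \<inter> (\<Inter>t\<in>B. {t<..})"
      by (rule eventually_in_open_at(2))
    moreover have "\<forall>\<^sub>F s in at_left a. s < a" by (simp add: eventually_at_filter)
    ultimately have "\<forall>\<^sub>F s in at_left a. s \<in> U \<and> s < a \<and> (\<forall>t\<in>B. t < s)"
      by eventually_elim auto
    then show ?thesis using that eventually_happens'[OF trivial_limit_at_left_real] by blast
  qed
  let ?J = "U \<inter> {s<..}"
  have "is_interval ?J" using interval_U by (auto simp: is_interval_1)
  moreover have "?J \<subseteq> U - B" using s by force
  ultimately obtain m c where m: "\<And>t. t \<in> ?J \<Longrightarrow> h t = of_int m * t + c"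
    using affine_offD[OF h(1)] by metis
  have "open ?J" using open_U by auto
  moreover have "a \<in> ?J" using assms s by auto
  ultimately have "has_slope h (at_left a) m"
    using has_slope_affine[of ?J h m c] m eventually_in_open_at(2) by blast
  moreover have "has_slope h E m"
    using has_slope_affine[of ?J h m c] m eventually_E[OF s(1)] by (auto elim: eventually_mono)
  ultimately show ?thesis using slopeI E one_sided_at_left by metis
qed

lemma slope_start:
  assumes "a \<in> U" "\<forall>t\<in>B. a < t"
  shows "slope h S = slope h (at_right a)"
proof -
  obtain s where s: "s \<in> U" "a < s" "\<forall>t\<in>B. s < t"
  proof -
    have "open (U \<inter> (\<Inter>t\<in>B. {..<t}))" using open_U B(1) by (intro open_Int open_INT) auto
    moreover have "a \<in> U \<inter> (\<Inter>t\<in>B. {..<t})" using assms by auto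
    ultimately have "\<forall>\<^sub>F s in at_right a. s \<in> U \<inter> (\<Inter>t\<in>B. {..<t})"
      by (rule eventually_in_open_at(1))
    moreover have "\<forall>\<^sub>F s in at_right a. a < s" by (simp add: eventually_at_filter)
    ultimately have "\<forall>\<^sub>F s in at_right a. s \<in> U \<and> a < s \<and> (\<forall>t\<in>B. s < t)"
      by eventually_elim auto
    then show ?thesis using that eventually_happens'[OF trivial_limit_at_right_real] by blast
  qed
  let ?J = "U \<inter> {..<s}"
  have "is_interval ?J" using interval_U by (auto simp: is_interval_1)
  moreover have "?J \<subseteq> U - B" using s by force
  ultimately obtain m c where m: "\<And>t. t \<in> ?J \<Longrightarrow> h t = of_int m * t + c"
    using affine_offD[OF h(1)] by metis
  have "open ?J" using open_U by auto
  moreover have "a \<in> ?J" using assms s by auto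
  ultimately have "has_slope h (at_right a) m"
    using has_slope_affine[of ?J h m c] m eventually_in_open_at(1) by blast
  moreover have "has_slope h S m"
    using has_slope_affine[of ?J h m c] m eventually_S[OF s(1)] by (auto elim: eventually_mono)
  ultimately show ?thesis using slopeI S one_sided_at_right by metis
qed

lemma sum_kink_above:
  assumes a: "a \<in> U"
  shows "(\<Sum>t\<in>B \<inter> {a<..}. kink h t) = slope h E - slope h (at_right a)"
proof -
  obtain b where b: "b \<in> U" "\<forall>t\<in>B \<inter> U \<union> {a}. t < b"
    using ex_above[of "insert a B"] B a by auto
  then have "B \<inter> {a<..} = B \<inter> {a<..<b}" using B by auto
  moreover have "real_of_int (\<Sum>t\<in>B \<inter> {a<..<b}. kink h t)
      = of_int (slope h (at_left b) - slope h (at_right a))"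
    using sum_kink_between[OF a b(1), of 0 1] b by simp
  moreover have "slope h E = slope h (at_left b)" using slope_end b B by blast
  ultimately show ?thesis by (simp only: of_int_eq_iff)
qed

lemma sum_kink: "(\<Sum>t\<in>B. kink h t) = slope h E - slope h S"
proof -
  obtain a where a: "a \<in> U" "\<forall>t\<in>B \<inter> U. a < t"
    using ex_below[OF B(1)] by auto
  then have *: "\<forall>t\<in>B. a < t" using B(2) by auto
  have "B \<inter> {a<..} = B" using * by auto
  moreover have "slope h S = slope h (at_right a)" by (rule slope_start[OF a(1) *])
  ultimately show ?thesis using sum_kink_above[OF a(1)] by simp
qed

text \<open>Below \<open>a\<close> the ramp vanishes, between \<open>a\<close> and \<open>b\<close>
  it is the affine function of Green's formula, and from \<open>b\<close> on only the total kink
  counts. A kink at \<open>b\<close> is split off because Green's formula covers the open interval;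
  one at \<open>a\<close> has weight 0. Of \<open>h\<close> only two values and the end slope
  survive, and the latter will cancel against the vertex term.\<close>

lemma sum_kink_ramp:
  assumes ab: "a \<in> U" "b \<in> U" "a < b"
  shows "(\<Sum>t\<in>B. of_int (kink h t) * ramp a b t) = of_int (slope h E) - (h b - h a) / (b - a)"
proof -
  let ?g = "\<lambda>t. of_int (kink h t) * ramp a b t"
  have "sum ?g B = sum ?g (B \<inter> {a<..<b}) + sum ?g (B \<inter> {b}) + sum ?g (B \<inter> {b<..})"
  proof -
    have "sum ?g B = sum ?g (B \<inter> {a<..<b} \<union> B \<inter> {b} \<union> B \<inter> {b<..})"
    proof (rule sum.mono_neutral_right)
      show "\<forall>t\<in>B - (B \<inter> {a<..<b} \<union> B \<inter> {b} \<union> B \<inter> {b<..}). ?g t = 0"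
      proof
        fix t assume "t \<in> B - (B \<inter> {a<..<b} \<union> B \<inter> {b} \<union> B \<inter> {b<..})"
        then have "t \<le> a" using ab by auto
        then show "?g t = 0" using ab by simp
      qed
    qed (use B in auto)
    also have "\<dots> = sum ?g (B \<inter> {a<..<b} \<union> B \<inter> {b}) + sum ?g (B \<inter> {b<..})"
      by (rule sum.union_disjoint) (use B in auto)
    also have "sum ?g (B \<inter> {a<..<b} \<union> B \<inter> {b}) = sum ?g (B \<inter> {a<..<b}) + sum ?g (B \<inter> {b})"
      by (rule sum.union_disjoint) (use B in auto)
    finally show ?thesis .
  qed
  moreover have "sum ?g (B \<inter> {a<..<b}) =
      (\<Sum>t\<in>B \<inter> {a<..<b}. of_int (kink h t) * (1 / (b - a) * t + - a / (b - a)))"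
    by (rule sum.cong) (use ab in \<open>auto simp: ramp_between diff_divide_distrib\<close>)
  moreover have "1 / (b - a) * b + - a / (b - a) = 1" "1 / (b - a) * a + - a / (b - a) = 0"
    using ab by (simp_all flip: diff_divide_distrib)
  ultimately have "sum ?g B = of_int (slope h (at_left b)) - (h b - h a) / (b - a)
      + sum ?g (B \<inter> {b}) + sum ?g (B \<inter> {b<..})"
    using sum_kink_between[OF ab, of "1 / (b - a)" "- a / (b - a)"] ab by simp
  moreover have "sum ?g (B \<inter> {b}) = of_int (kink h b)"
    using kink_eq_0[OF h(1) B(1) open_U ab(2)] ab by (cases "b \<in> B") auto
  moreover have "real_of_int (kink h b) = of_int (slope h (at_right b)) - of_int (slope h (at_left b))"
    by (simp add: kink_def)
  moreover have "sum ?g (B \<inter> {b<..}) = of_int (\<Sum>t\<in>B \<inter> {b<..}. kink h t)"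
    using ab by (simp add: of_int_sum)
  then have "sum ?g (B \<inter> {b<..}) = of_int (slope h E) - of_int (slope h (at_right b))"
    by (simp only: sum_kink_above[OF ab(2)] of_int_diff)
  ultimately show ?thesis by linarith
qed

text \<open>\<open>B\<close> may contain points where \<open>h\<close> does not bend, so affine
  pieces have to be joined. Green's formula against the functions 1 and \<open>t\<close> gives equal
  slopes at the ends of a subinterval and then the increment over it.\<close>

lemma affine_if_no_kinks:
  assumes 0: "\<And>t. t \<in> U \<Longrightarrow> kink h t = 0"
  shows "slope h E = slope h S" and "\<exists>c. \<forall>t\<in>U. h t = of_int (slope h S) * t + c"
proof -
  have z: "sum (\<lambda>t. of_int (kink h t) * g t) (B \<inter> A) = (0::real)" "sum (kink h) (B \<inter> A) = 0" for g A
    using 0 B by (auto intro!: sum.neutral)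
  show ES: "slope h E = slope h S" using sum_kink z(2)[of UNIV] by simp
  have r: "slope h (at_right a) = slope h S" if "a \<in> U" for a
    using sum_kink_above[OF that] z ES by simp
  have d: "h b - h a = of_int (slope h S) * (b - a)" if "a \<in> U" "b \<in> U" "a < b" for a b
  proof -
    have "of_int (slope h (at_left b)) = real_of_int (slope h (at_right a))"
      using sum_kink_between[OF that, of 0 1] z(1)[of "\<lambda>_. 1"] by simp
    then show ?thesis
      using sum_kink_between[OF that, of 1 0] z(1)[of "\<lambda>t. t"] r[OF that(1)] by (simp add: algebra_simps)
  qed
  obtain a where a: "a \<in> U" using U_ne by blast
  have "h t = of_int (slope h S) * t + (h a - of_int (slope h S) * a)" if "t \<in> U" for t
    using d[OF a that] d[OF that a] by (cases t a rule: linorder_cases) (auto simp: algebra_simps)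
  then show "\<exists>c. \<forall>t\<in>U. h t = of_int (slope h S) * t + c" by blast
qed

end

end

section \<open>Functions on a tropical curve\<close>

lemma tropical_curveD:
  assumes "tropical_curve G"
  shows "finite (verts G)" "verts G \<noteq> {}" "finite (edges G)"
    and "\<And>e. e \<in> edges G \<Longrightarrow> src G e \<in> verts G"
    and "\<And>e. e \<in> edges G \<Longrightarrow> tgt G e \<in> verts G"
    and "\<And>e. e \<in> edges G \<Longrightarrow> 0 < len G e"
    and "connected_space (curve_topology G)"
  using assms by (auto simp: tropical_curve_def)

lemma Vertex_in_points [simp]: "Vertex v \<in> points G \<longleftrightarrow> v \<in> verts G"
  and Inner_in_points [simp]: "Inner e t \<in> points G \<longleftrightarrow> e \<in> edges G \<and> t \<in> edge_interior G e"
  by (auto simp: points_def)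

lemma edge_map_interior:
  assumes "t \<in> edge_interior G e"
  shows "edge_map G e (ereal t) = Inner e t"
  using assms by (auto simp: edge_map_def edge_interior_def)

lemma edge_map_0 [simp]: "edge_map G e 0 = Vertex (src G e)"
  by (simp add: edge_map_def)

lemma edge_map_len: "0 < len G e \<Longrightarrow> edge_map G e (len G e) = Vertex (tgt G e)"
  by (auto simp: edge_map_def)

lemma edge_parameter_cases:
  assumes "s \<in> {0..len G e}"
  obtains "s = 0" | "s = len G e" | t where "s = ereal t" "t \<in> edge_interior G e"
  using assms by (cases s; cases "len G e") (force simp: edge_interior_def less_le zero_ereal_def)+

lemma edge_map_in_points:
  assumes "tropical_curve G" "e \<in> edges G" "s \<in> {0..len G e}"
  shows "edge_map G e s \<in> points G"
  using assms(3)
  by (rule edge_parameter_cases)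
     (use assms tropical_curveD[OF assms(1)] in \<open>auto simp: edge_map_interior edge_map_len\<close>)

lemma continuous_map_edge_map:
  assumes "tropical_curve G" "e \<in> edges G"
  shows "continuous_map (top_of_set {0..len G e}) (curve_topology G) (edge_map G e)"
  using assms edge_map_in_points[OF assms]
  by (auto simp: continuous_map_def topspace_curve_topology openin_curve_topology)

text \<open>The topology of the curve is final for the edge parametrisations, so continuity can be
  tested on each closed edge.\<close>

lemma continuous_map_curve:
  fixes f :: "('v, 'e) point \<Rightarrow> real"
  assumes "tropical_curve G"
  shows "continuous_map (curve_topology G) euclideanreal f \<longleftrightarrow>
    (\<forall>e\<in>edges G. continuous_on {0..len G e} (\<lambda>s. f (edge_map G e s)))"
proof (intro iffI ballI)
  fix e assume "continuous_map (curve_topology G) euclideanreal f" "e \<in> edges G"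
  then have "continuous_map (top_of_set {0..len G e}) euclideanreal (f \<circ> edge_map G e)"
    using continuous_map_compose continuous_map_edge_map[OF assms] by blast
  then show "continuous_on {0..len G e} (\<lambda>s. f (edge_map G e s))"
    by (simp add: o_def)
next
  assume *: "\<forall>e\<in>edges G. continuous_on {0..len G e} (\<lambda>s. f (edge_map G e s))"
  show "continuous_map (curve_topology G) euclideanreal f"
    unfolding continuous_map_def openin_curve_topology topspace_curve_topology[OF assms]
  proof (intro conjI allI impI ballI)
    fix V and e assume V: "openin euclideanreal V" and e: "e \<in> edges G"
    have "continuous_map (top_of_set {0..len G e}) euclideanreal (\<lambda>s. f (edge_map G e s))"
      using * e by simp
    then have "openin (top_of_set {0..len G e}) {s \<in> {0..len G e}. f (edge_map G e s) \<in> V}"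
      using V unfolding continuous_map_def by auto
    moreover have "{s \<in> {0..len G e}. f (edge_map G e s) \<in> V}
        = {s \<in> {0..len G e}. edge_map G e s \<in> {x \<in> points G. f x \<in> V}}"
      using edge_map_in_points[OF assms e] by auto
    ultimately show "openin (top_of_set {0..len G e})
        {s \<in> {0..len G e}. edge_map G e s \<in> {x \<in> points G. f x \<in> V}}" by simp
  qed auto
qed

text \<open>Closed intervals of extended reals are compact, infinite edges included, and finitely
  many of them cover the curve together with the vertices. The vertices are listed separately
  because the curve may be a single vertex without edges.\<close>

lemma compact_space_curve:
  assumes G: "tropical_curve G"
  shows "compact_space (curve_topology G)"
proof -
  have "compactin (curve_topology G) (edge_map G e ` {0..len G e})" if "e \<in> edges G" for e
  proof (rule image_compactin[OF _ continuous_map_edge_map[OF G that]])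
    show "compactin (top_of_set {0..len G e}) {0..len G e}"
      by (simp add: compactin_subtopology compact_eq_closed)
  qed
  then have "compactin (curve_topology G) (\<Union>e\<in>edges G. edge_map G e ` {0..len G e})"
    using tropical_curveD(3)[OF G] by (intro compactin_Union) auto
  moreover have "compactin (curve_topology G) (Vertex ` verts G)"
    using tropical_curveD(1)[OF G]
    by (intro finite_imp_compactin) (auto simp: topspace_curve_topology[OF G])
  ultimately have "compactin (curve_topology G)
      (Vertex ` verts G \<union> (\<Union>e\<in>edges G. edge_map G e ` {0..len G e}))"
    by (intro compactin_Un)
  also have "Vertex ` verts G \<union> (\<Union>e\<in>edges G. edge_map G e ` {0..len G e}) = points G"
  proof
    show "Vertex ` verts G \<union> (\<Union>e\<in>edges G. edge_map G e ` {0..len G e}) \<subseteq> points G"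
      using edge_map_in_points[OF G] by auto
    show "points G \<subseteq> Vertex ` verts G \<union> (\<Union>e\<in>edges G. edge_map G e ` {0..len G e})"
    proof
      fix x assume "x \<in> points G"
      then consider v where "x = Vertex v" "v \<in> verts G"
        | e t where "x = Inner e t" "e \<in> edges G" "t \<in> edge_interior G e"
        by (auto simp: points_def)
      then show "x \<in> Vertex ` verts G \<union> (\<Union>e\<in>edges G. edge_map G e ` {0..len G e})"
      proof cases
        case 2
        then have "x = edge_map G e (ereal t)" "ereal t \<in> {0..len G e}"
          by (auto simp: edge_map_interior edge_interior_def)
        then show ?thesis using 2 by blast
      qed auto
    qed
  qed
  finally show ?thesis by (simp add: compact_space_def topspace_curve_topology[OF G])
qed

lemma open_edge_interior:
  assumes G: "tropical_curve G" and e: "e \<in> edges G"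
  shows "open_edge (edge_interior G e) (at_right 0) (tgt_filter G e)"
proof (cases "len G e")
  case (real L)
  then have "0 < L" using tropical_curveD(6)[OF G e] by simp
  moreover have U: "edge_interior G e = {0<..<L}" by (auto simp: edge_interior_def real)
  moreover have "\<forall>\<^sub>F t in at_right 0. t \<in> {0<..<s}" if "0 < s" for s :: real
    using that by (auto simp: eventually_at_right_field)
  moreover have "\<forall>\<^sub>F t in at_left L. t \<in> {s<..<L}" if "s < L" for s :: real
    using that by (auto simp: eventually_at_left_field)
  ultimately show ?thesis
    by unfold_locales
       (force simp: real tgt_filter_def one_sided_at_left one_sided_at_right is_interval_1 elim: eventually_mono)+
next
  case PInf
  moreover have U: "edge_interior G e = {0<..}" by (auto simp: edge_interior_def PInf)
  moreover have "\<forall>\<^sub>F t in at_right 0. t \<in> {0<..<s}" if "0 < s" for s :: real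
    using that by (auto simp: eventually_at_right_field)
  moreover have "\<forall>\<^sub>F t in at_top. t \<in> {0<..} \<and> s < t" for s :: real
    using eventually_gt_at_top[of 0] eventually_gt_at_top[of s] by eventually_elim auto
  ultimately show ?thesis
    by unfold_locales
       (force simp: tgt_filter_def one_sided_at_top one_sided_at_right is_interval_1 elim: eventually_mono)+
next
  case MInf
  then show ?thesis using tropical_curveD(6)[OF G e] by simp
qed

section \<open>Restriction of a continuous function to an edge, and its limits at the two
  ends\<close>

context
  fixes G :: "('v, 'e) metric_graph" and f :: "('v, 'e) point \<Rightarrow> real" and e :: 'e
  assumes G: "tropical_curve G" and f: "continuous_map (curve_topology G) euclideanreal f"
    and e: "e \<in> edges G"
begin

lemma continuous_on_edge: "continuous_on {0..len G e} (\<lambda>s. f (edge_map G e s))"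
  using continuous_map_curve[OF G] f e by blast

lemma continuous_on_edge_interior: "continuous_on (edge_interior G e) (\<lambda>t. f (Inner e t))"
proof -
  have "continuous_on (edge_interior G e) (\<lambda>t. f (edge_map G e (ereal t)))"
    by (rule continuous_on_compose2[OF continuous_on_edge])
       (auto simp: edge_interior_def intro!: continuous_intros)
  then show ?thesis
    by (rule continuous_on_eq) (simp add: edge_map_interior)
qed

lemma tendsto_src: "((\<lambda>t. f (Inner e t)) \<longlongrightarrow> f (Vertex (src G e))) (at_right 0)"
proof -
  interpret open_edge "edge_interior G e" "at_right 0" "tgt_filter G e"
    by (rule open_edge_interior[OF G e])
  have "((\<lambda>s. f (edge_map G e s)) \<longlongrightarrow> f (edge_map G e 0)) (at 0 within {0..len G e})"
    using continuous_on_edge tropical_curveD(6)[OF G e] unfolding continuous_on_def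
    by (auto simp del: edge_map_0)
  moreover have "filterlim ereal (at 0 within {0..len G e}) (at_right 0)"
    unfolding filterlim_at
  proof
    have "(ereal \<longlongrightarrow> ereal 0) (at_right 0)" by (intro tendsto_intros)
    then show "(ereal \<longlongrightarrow> 0) (at_right 0)" by (simp add: zero_ereal_def)
    show "\<forall>\<^sub>F t in at_right 0. ereal t \<in> {0..len G e} \<and> ereal t \<noteq> 0"
      using eventually_in_U(1) by eventually_elim (auto simp: edge_interior_def)
  qed
  ultimately have "((\<lambda>t. f (edge_map G e (ereal t))) \<longlongrightarrow> f (Vertex (src G e))) (at_right 0)"
    using filterlim_compose by fastforce
  then show ?thesis
    by (rule Lim_transform_eventually)
       (use eventually_in_U(1) in \<open>auto elim!: eventually_mono simp: edge_map_interior\<close>)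
qed

text \<open>At a point at infinity this is a limit along \<open>at_top\<close>, because
  \<open>ereal\<close> carries that filter into punctured neighbourhoods of infinity.\<close>

lemma tendsto_tgt: "((\<lambda>t. f (Inner e t)) \<longlongrightarrow> f (Vertex (tgt G e))) (tgt_filter G e)"
proof -
  interpret open_edge "edge_interior G e" "at_right 0" "tgt_filter G e"
    by (rule open_edge_interior[OF G e])
  have pos: "0 < len G e" by (rule tropical_curveD(6)[OF G e])
  have "((\<lambda>s. f (edge_map G e s)) \<longlongrightarrow> f (edge_map G e (len G e))) (at (len G e) within {0..len G e})"
    using continuous_on_edge pos unfolding continuous_on_def by auto
  moreover have "filterlim ereal (at (len G e) within {0..len G e}) (tgt_filter G e)"
    unfolding filterlim_at
  proof
    show "(ereal \<longlongrightarrow> len G e) (tgt_filter G e)"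
    proof (cases "len G e")
      case (real L)
      have "(ereal \<longlongrightarrow> ereal L) (at_left L)" by (intro tendsto_intros)
      then show ?thesis by (simp add: real tgt_filter_def)
    next
      case PInf
      then show ?thesis by (simp add: tgt_filter_def tendsto_PInfty eventually_gt_at_top)
    qed (use pos in auto)
    show "\<forall>\<^sub>F t in tgt_filter G e. ereal t \<in> {0..len G e} \<and> ereal t \<noteq> len G e"
      using eventually_in_U(2) by eventually_elim (auto simp: edge_interior_def)
  qed
  ultimately have "((\<lambda>t. f (edge_map G e (ereal t))) \<longlongrightarrow> f (Vertex (tgt G e))) (tgt_filter G e)"
    using filterlim_compose edge_map_len[OF pos] by fastforce
  then show ?thesis
    by (rule Lim_transform_eventually)
       (use eventually_in_U(2) in \<open>auto elim!: eventually_mono simp: edge_map_interior\<close>)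
qed

end

section \<open>Rational functions\<close>

lemma affine_off_cong:
  assumes "\<And>t. t \<in> U \<Longrightarrow> h t = g t"
  shows "affine_off U B h \<longleftrightarrow> affine_off U B g"
proof -
  have "(\<forall>t\<in>I. h t = of_int m * t + c) \<longleftrightarrow> (\<forall>t\<in>I. g t = of_int m * t + c)" if "I \<subseteq> U - B" for I m c
    using that assms by (intro ball_cong) auto
  then show ?thesis unfolding affine_off_def by metis
qed

lemma germ_slope_eq: "germ_slope f e F = slope (\<lambda>t. f (Inner e t)) F"
  by (simp add: germ_slope_def slope_def has_slope_def)

lemma ord_at_Inner: "ord_at G f (Inner e t) = kink (\<lambda>t. f (Inner e t)) t"
  by (simp add: kink_def germ_slope_eq)

lemma rational_function_iff:
  "rational_function G f \<longleftrightarrow> f \<in> extensional (points G) \<and>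
     continuous_map (curve_topology G) euclideanreal f \<and>
     (\<forall>e\<in>edges G. \<exists>B. finite B \<and> affine_off (edge_interior G e) B (\<lambda>t. f (Inner e t)))"
  by (simp add: rational_function_def affine_off_def)

lemma rational_functionD:
  assumes "rational_function G f"
  shows "f \<in> extensional (points G)" "continuous_map (curve_topology G) euclideanreal f"
  using assms by (auto simp: rational_function_iff)

lemma rational_function_breakpoints:
  assumes "rational_function G f" "e \<in> edges G"
  obtains B where "finite B" "B \<subseteq> edge_interior G e"
    "affine_off (edge_interior G e) B (\<lambda>t. f (Inner e t))"
proof -
  obtain B where B: "finite B" "affine_off (edge_interior G e) B (\<lambda>t. f (Inner e t))"
    using assms by (auto simp: rational_function_iff)
  have "affine_off (edge_interior G e) (B \<inter> edge_interior G e) (\<lambda>t. f (Inner e t))"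
    by (rule affine_off_mono[OF B(2)]) auto
  with B(1) show ?thesis using that[of "B \<inter> edge_interior G e"] by auto
qed

section \<open>Orders of rational functions under comparison, translation, difference and
  maximum\<close>

lemma rational_has_slope:
  assumes G: "tropical_curve G" and f: "rational_function G f" and e: "e \<in> edges G"
  shows "has_slope (\<lambda>t. f (Inner e t)) (at_right 0) (germ_slope f e (at_right 0))"
    and "has_slope (\<lambda>t. f (Inner e t)) (tgt_filter G e) (germ_slope f e (tgt_filter G e))"
    and "t \<in> edge_interior G e \<Longrightarrow>
      has_slope (\<lambda>t. f (Inner e t)) (at_right t) (germ_slope f e (at_right t))"
    and "t \<in> edge_interior G e \<Longrightarrow>
      has_slope (\<lambda>t. f (Inner e t)) (at_left t) (germ_slope f e (at_left t))"
proof -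
  interpret open_edge "edge_interior G e" "at_right 0" "tgt_filter G e"
    by (rule open_edge_interior[OF G e])
  obtain B where B: "finite B" "affine_off (edge_interior G e) B (\<lambda>t. f (Inner e t))"
    using rational_function_breakpoints[OF f e] by metis
  note * = affine_off_has_slope[OF B(2) _ B(1)]
  show "has_slope (\<lambda>t. f (Inner e t)) (at_right 0) (germ_slope f e (at_right 0))"
    and "has_slope (\<lambda>t. f (Inner e t)) (tgt_filter G e) (germ_slope f e (tgt_filter G e))"
    unfolding germ_slope_eq by (rule *[OF S eventually_in_U(1)] *[OF E eventually_in_U(2)])+
  show "has_slope (\<lambda>t. f (Inner e t)) (at_right t) (germ_slope f e (at_right t))"
    and "has_slope (\<lambda>t. f (Inner e t)) (at_left t) (germ_slope f e (at_left t))"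
    if "t \<in> edge_interior G e"
    unfolding germ_slope_eq
    using *[OF one_sided_at_right eventually_in_open_at(1)[OF open_U that]]
      *[OF one_sided_at_left eventually_in_open_at(2)[OF open_U that]] by auto
qed

text \<open>Where \<open>f\<close> touches \<open>h\<close> from below, each outgoing slope of
  \<open>f\<close> is at most that of \<open>h\<close>. At a target end the outgoing slope is the
  negative of the germ slope, which reverses the comparison. This is the source of closure of R(D)
  under maxima.\<close>

lemma ord_at_mono:
  assumes G: "tropical_curve G" and f: "rational_function G f" and h: "rational_function G h"
    and le: "\<And>y. y \<in> points G \<Longrightarrow> f y \<le> h y" and x: "x \<in> points G" "f x = h x"
  shows "ord_at G f x \<le> ord_at G h x"
proof (cases x)
  case (Inner e t)
  then have e: "e \<in> edges G" and t: "t \<in> edge_interior G e" using x by auto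
  interpret open_edge "edge_interior G e" "at_right 0" "tgt_filter G e"
    by (rule open_edge_interior[OF G e])
  note ev = eventually_in_open_at[OF open_U t]
  note lim_f = continuous_on_open_one_sided[OF continuous_on_edge_interior[OF G rational_functionD(2)[OF f] e] open_U t]
  note lim_h = continuous_on_open_one_sided[OF continuous_on_edge_interior[OF G rational_functionD(2)[OF h] e] open_U t]
  have "\<forall>\<^sub>F s in at_right t. f (Inner e s) \<le> h (Inner e s)"
    using ev(1) by eventually_elim (use e le in auto)
  then have "germ_slope f e (at_right t) \<le> germ_slope h e (at_right t)"
    using slope_mono_at_right[OF rational_has_slope(3)[OF G f e t] lim_f(1) rational_has_slope(3)[OF G h e t]]
      lim_h(1) x(2) Inner by simp
  moreover have "\<forall>\<^sub>F s in at_left t. f (Inner e s) \<le> h (Inner e s)"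
    using ev(2) by eventually_elim (use e le in auto)
  then have "germ_slope h e (at_left t) \<le> germ_slope f e (at_left t)"
    using slope_mono_at_left[OF rational_has_slope(4)[OF G f e t] lim_f(2) rational_has_slope(4)[OF G h e t]]
      lim_h(2) x(2) Inner by simp
  ultimately show ?thesis by (simp add: Inner)
next
  case (Vertex v)
  have "germ_slope f e (at_right 0) \<le> germ_slope h e (at_right 0)"
    if e: "e \<in> edges G" and v: "src G e = v" for e
  proof -
    interpret open_edge "edge_interior G e" "at_right 0" "tgt_filter G e"
      by (rule open_edge_interior[OF G e])
    have "\<forall>\<^sub>F s in at_right 0. f (Inner e s) \<le> h (Inner e s)"
      using eventually_in_U(1) by eventually_elim (use e le in auto)
    then show ?thesis
      using slope_mono_at_right[OF rational_has_slope(1)[OF G f e] tendsto_src[OF G rational_functionD(2)[OF f] e]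
          rational_has_slope(1)[OF G h e]] tendsto_src[OF G rational_functionD(2)[OF h] e] x(2) v Vertex
      by simp
  qed
  moreover have "germ_slope h e (tgt_filter G e) \<le> germ_slope f e (tgt_filter G e)"
    if e: "e \<in> edges G" and v: "tgt G e = v" for e
  proof -
    interpret open_edge "edge_interior G e" "at_right 0" "tgt_filter G e"
      by (rule open_edge_interior[OF G e])
    note sf = rational_has_slope(2)[OF G f e] and sh = rational_has_slope(2)[OF G h e]
    note tf = tendsto_tgt[OF G rational_functionD(2)[OF f] e]
    note th = tendsto_tgt[OF G rational_functionD(2)[OF h] e]
    have le': "\<forall>\<^sub>F s in tgt_filter G e. f (Inner e s) \<le> h (Inner e s)"
      using eventually_in_U(2) by eventually_elim (use e le in auto)
    show ?thesis
    proof (cases "len G e = \<infinity>")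
      \<comment> \<open>At a point at infinity both slopes are 0, because both functions have a real
        limit there.\<close>
      case True
      then show ?thesis
        using has_slope_at_top_limit[of "\<lambda>t. f (Inner e t)"] has_slope_at_top_limit[of "\<lambda>t. h (Inner e t)"] sf sh tf th
        by (metis order_refl tgt_filter_def)
    next
      case False
      then have F: "tgt_filter G e = at_left (real_of_ereal (len G e))" by (simp add: tgt_filter_def)
      show ?thesis
        using slope_mono_at_left[OF sf[unfolded F] tf[unfolded F] sh[unfolded F] _ le'[unfolded F]]
          th[unfolded F] x(2) v Vertex F by simp
    qed
  qed
  ultimately show ?thesis
    by (auto simp: Vertex intro!: diff_mono sum_mono)
qed

lemma rational_function_add_const:
  assumes G: "tropical_curve G" and f: "rational_function G f"
  shows "rational_function G (\<lambda>x\<in>points G. a + f x)"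
  unfolding rational_function_iff
proof (intro conjI ballI)
  have "continuous_map (curve_topology G) euclideanreal (\<lambda>x. a + f x)"
    using rational_functionD(2)[OF f] by (intro continuous_intros) auto
  then show "continuous_map (curve_topology G) euclideanreal (\<lambda>x\<in>points G. a + f x)"
    by (rule continuous_map_eq) (simp add: topspace_curve_topology[OF G])
  fix e assume e: "e \<in> edges G"
  obtain B where B: "finite B" "affine_off (edge_interior G e) B (\<lambda>t. f (Inner e t))"
    using rational_function_breakpoints[OF f e] by metis
  have "affine_off (edge_interior G e) B (\<lambda>t. (\<lambda>x\<in>points G. a + f x) (Inner e t))"
    by (rule affine_off_cong[THEN iffD1, OF _ affine_off_add_const[OF B(2)]]) (use e in simp)
  with B(1) show "\<exists>B. finite B \<and>
      affine_off (edge_interior G e) B (\<lambda>t. (\<lambda>x\<in>points G. a + f x) (Inner e t))"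
    by blast
qed simp

lemma rational_function_diff:
  assumes G: "tropical_curve G" and f: "rational_function G f" and g: "rational_function G g"
  shows "rational_function G (\<lambda>x\<in>points G. f x - g x)"
  unfolding rational_function_iff
proof (intro conjI ballI)
  have "continuous_map (curve_topology G) euclideanreal (\<lambda>x. f x - g x)"
    using rational_functionD(2)[OF f] rational_functionD(2)[OF g] by (intro continuous_intros) auto
  then show "continuous_map (curve_topology G) euclideanreal (\<lambda>x\<in>points G. f x - g x)"
    by (rule continuous_map_eq) (simp add: topspace_curve_topology[OF G])
  fix e assume e: "e \<in> edges G"
  obtain B where B: "finite B" "affine_off (edge_interior G e) B (\<lambda>t. f (Inner e t))"
    using rational_function_breakpoints[OF f e] by metis
  obtain C where C: "finite C" "affine_off (edge_interior G e) C (\<lambda>t. g (Inner e t))"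
    using rational_function_breakpoints[OF g e] by metis
  have "affine_off (edge_interior G e) (B \<union> C) (\<lambda>t. (\<lambda>x\<in>points G. f x - g x) (Inner e t))"
    by (rule affine_off_cong[THEN iffD1, OF _ affine_off_diff[OF B(2) C(2)]]) (use e in simp)
  with B(1) C(1) show "\<exists>B. finite B \<and>
      affine_off (edge_interior G e) B (\<lambda>t. (\<lambda>x\<in>points G. f x - g x) (Inner e t))"
    by (meson finite_UnI)
qed simp

text \<open>The additive constant in the description of \<open>h\<close> lets the same statement
  yield the invariance of orders under translation.\<close>

lemma ord_at_diff:
  assumes G: "tropical_curve G" and f: "rational_function G f" and g: "rational_function G g"
    and x: "x \<in> points G"
    and h: "\<And>y. y \<in> points G \<Longrightarrow> h y = a + (f y - g y)"
  shows "ord_at G h x = ord_at G f x - ord_at G g x"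
proof -
  have slope: "germ_slope h e F = germ_slope f e F - germ_slope g e F"
    if e: "e \<in> edges G" and F: "one_sided F" "\<forall>\<^sub>F t in F. t \<in> edge_interior G e"
      and "has_slope (\<lambda>t. f (Inner e t)) F (germ_slope f e F)"
      and "has_slope (\<lambda>t. g (Inner e t)) F (germ_slope g e F)" for e F
  proof -
    have "\<forall>\<^sub>F t in F. h (Inner e t) = a + (f (Inner e t) - g (Inner e t))"
      using F(2) by eventually_elim (use e h in simp)
    from has_slope_cong[OF this] have "has_slope (\<lambda>t. h (Inner e t)) F (germ_slope f e F - germ_slope g e F)"
      using has_slope_add_const[OF has_slope_diff[OF that(4,5)]] by blast
    then show ?thesis unfolding germ_slope_eq[of h] by (rule slopeI[OF F(1)])
  qed
  have edge: "germ_slope h e (at_right 0) = germ_slope f e (at_right 0) - germ_slope g e (at_right 0)"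
    "germ_slope h e (tgt_filter G e) = germ_slope f e (tgt_filter G e) - germ_slope g e (tgt_filter G e)"
    if e: "e \<in> edges G" for e
  proof -
    interpret open_edge "edge_interior G e" "at_right 0" "tgt_filter G e"
      by (rule open_edge_interior[OF G e])
    show "germ_slope h e (at_right 0) = germ_slope f e (at_right 0) - germ_slope g e (at_right 0)"
      by (rule slope[OF e S eventually_in_U(1) rational_has_slope(1)[OF G f e] rational_has_slope(1)[OF G g e]])
    show "germ_slope h e (tgt_filter G e) = germ_slope f e (tgt_filter G e) - germ_slope g e (tgt_filter G e)"
      by (rule slope[OF e E eventually_in_U(2) rational_has_slope(2)[OF G f e] rational_has_slope(2)[OF G g e]])
  qed
  show ?thesis
  proof (cases x)
    case (Inner e t)
    then have e: "e \<in> edges G" and t: "t \<in> edge_interior G e" using x by auto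
    interpret open_edge "edge_interior G e" "at_right 0" "tgt_filter G e"
      by (rule open_edge_interior[OF G e])
    note ev = eventually_in_open_at[OF open_U t]
    note slope[OF e one_sided_at_right ev(1) rational_has_slope(3)[OF G f e t] rational_has_slope(3)[OF G g e t]]
      slope[OF e one_sided_at_left ev(2) rational_has_slope(4)[OF G f e t] rational_has_slope(4)[OF G g e t]]
    then show ?thesis by (simp add: Inner)
  next
    case (Vertex v)
    then show ?thesis by (simp add: edge sum_subtractf)
  qed
qed

lemma rational_function_max:
  assumes G: "tropical_curve G" and f: "rational_function G f" and g: "rational_function G g"
  shows "rational_function G (\<lambda>x\<in>points G. max (f x) (g x))"
  unfolding rational_function_iff
proof (intro conjI ballI)
  show "continuous_map (curve_topology G) euclideanreal (\<lambda>x\<in>points G. max (f x) (g x))"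
    by (rule continuous_map_eq[OF continuous_map_real_max[OF rational_functionD(2)[OF f] rational_functionD(2)[OF g]]])
       (simp add: topspace_curve_topology[OF G])
  fix e assume e: "e \<in> edges G"
  interpret open_edge "edge_interior G e" "at_right 0" "tgt_filter G e"
    by (rule open_edge_interior[OF G e])
  obtain B where B: "finite B" "affine_off (edge_interior G e) B (\<lambda>t. f (Inner e t))"
    using rational_function_breakpoints[OF f e] by metis
  obtain C where C: "finite C" "affine_off (edge_interior G e) C (\<lambda>t. g (Inner e t))"
    using rational_function_breakpoints[OF g e] by metis
  obtain D where D: "finite D" "affine_off (edge_interior G e) D (\<lambda>t. max (f (Inner e t)) (g (Inner e t)))"
    using affine_off_max[OF interval_U finite_UnI[OF B(1) C(1)]] affine_off_mono[OF B(2)] affine_off_mono[OF C(2)]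
    by (metis Diff_mono Un_upper1 Un_upper2 order_refl)
  have "affine_off (edge_interior G e) D (\<lambda>t. (\<lambda>x\<in>points G. max (f x) (g x)) (Inner e t))"
    by (rule affine_off_cong[THEN iffD1, OF _ D(2)]) (use e in simp)
  with D(1) show "\<exists>B. finite B \<and> affine_off (edge_interior G e) B (\<lambda>t. (\<lambda>x\<in>points G. max (f x) (g x)) (Inner e t))"
    by blast
qed simp

section \<open>Divisors\<close>

definition breakpoints ::
    "('v, 'e) metric_graph \<Rightarrow> (('v, 'e) point \<Rightarrow> real) \<Rightarrow> ('e \<Rightarrow> real set) \<Rightarrow> bool" where
  "breakpoints G f B \<longleftrightarrow> (\<forall>e\<in>edges G. finite (B e) \<and> B e \<subseteq> edge_interior G e \<and>
     affine_off (edge_interior G e) (B e) (\<lambda>t. f (Inner e t)))"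

lemma breakpointsD:
  assumes "breakpoints G f B" "e \<in> edges G"
  shows "finite (B e)" "B e \<subseteq> edge_interior G e"
    "affine_off (edge_interior G e) (B e) (\<lambda>t. f (Inner e t))"
  using assms by (auto simp: breakpoints_def)

lemma ex_breakpoints:
  assumes "rational_function G f"
  shows "\<exists>B. breakpoints G f B"
proof -
  have "\<forall>e\<in>edges G. \<exists>B. finite B \<and> B \<subseteq> edge_interior G e \<and>
      affine_off (edge_interior G e) B (\<lambda>t. f (Inner e t))"
    using rational_function_breakpoints[OF assms] by metis
  then show ?thesis unfolding breakpoints_def by (rule bchoice)
qed

context
  fixes G :: "('v, 'e) metric_graph" and f :: "('v, 'e) point \<Rightarrow> real" and B :: "'e \<Rightarrow> real set"
  assumes G: "tropical_curve G" and B: "breakpoints G f B"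
begin

lemma ord_support:
  "{x \<in> points G. ord_at G f x \<noteq> 0} \<subseteq> Vertex ` verts G \<union> (\<Union>e\<in>edges G. Inner e ` B e)"
proof safe
  fix x assume x: "x \<in> points G" "ord_at G f x \<noteq> 0" "x \<notin> (\<Union>e\<in>edges G. Inner e ` B e)"
  show "x \<in> Vertex ` verts G"
  proof (cases x)
    case (Inner e t)
    then have et: "e \<in> edges G" "t \<in> edge_interior G e" "t \<notin> B e" using x by auto
    interpret open_edge "edge_interior G e" "at_right 0" "tgt_filter G e"
      by (rule open_edge_interior[OF G et(1)])
    have "kink (\<lambda>t. f (Inner e t)) t = 0"
      by (rule kink_eq_0[OF breakpointsD(3,1)[OF B et(1)] open_U et(2,3)])
    then show ?thesis using x(2) Inner ord_at_Inner by metis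
  qed (use x in auto)
qed

lemma finite_support: "finite {x \<in> points G. ord_at G f x \<noteq> 0}"
  by (rule finite_subset[OF ord_support]) (use breakpointsD(1)[OF B] tropical_curveD[OF G] in auto)

text \<open>The sum over points is regrouped by edges. The order at a vertex is a sum over the
  incident edge ends, so each edge collects its inner kinks and two end terms; a loop enters once as
  a source and once as a target.\<close>

lemma sum_ord:
  "(\<Sum>x | x \<in> points G \<and> ord_at G f x \<noteq> 0. of_int (ord_at G f x) * \<phi> x) =
   (\<Sum>e\<in>edges G. (\<Sum>t\<in>B e. of_int (kink (\<lambda>t. f (Inner e t)) t) * \<phi> (Inner e t))
      + of_int (germ_slope f e (at_right 0)) * \<phi> (Vertex (src G e))
      - of_int (germ_slope f e (tgt_filter G e)) * \<phi> (Vertex (tgt G e)) :: real)"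
proof -
  let ?g = "\<lambda>x. of_int (ord_at G f x) * \<phi> x :: real"
  let ?V = "Vertex ` verts G" and ?E = "\<Union>e\<in>edges G. Inner e ` B e"
  note fin = tropical_curveD(1,3)[OF G]
  have "sum ?g {x \<in> points G. ord_at G f x \<noteq> 0} = sum ?g (?V \<union> ?E)"
    by (rule sum.mono_neutral_left) (use fin breakpointsD(1)[OF B] ord_support in \<open>auto dest: subsetD[OF breakpointsD(2)[OF B]]\<close>)
  also have "\<dots> = sum ?g ?V + sum ?g ?E"
    by (rule sum.union_disjoint) (use fin breakpointsD(1)[OF B] in auto)
  also have "sum ?g ?E = (\<Sum>e\<in>edges G. sum ?g (Inner e ` B e))"
    by (rule sum.UNION_disjoint) (use fin breakpointsD(1)[OF B] in auto)
  also have "\<dots> = (\<Sum>e\<in>edges G. \<Sum>t\<in>B e. of_int (kink (\<lambda>t. f (Inner e t)) t) * \<phi> (Inner e t))"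
    by (simp add: sum.reindex inj_on_def ord_at_Inner del: ord_at.simps)
  also have "sum ?g ?V = (\<Sum>v\<in>verts G. ?g (Vertex v))"
    by (simp add: sum.reindex inj_on_def del: ord_at.simps)
  also have "\<dots> = (\<Sum>v\<in>verts G. \<Sum>e | e \<in> edges G \<and> src G e = v. of_int (germ_slope f e (at_right 0)) * \<phi> (Vertex (src G e)))
      - (\<Sum>v\<in>verts G. \<Sum>e | e \<in> edges G \<and> tgt G e = v. of_int (germ_slope f e (tgt_filter G e)) * \<phi> (Vertex (tgt G e)))"
    by (simp add: sum_subtractf left_diff_distrib sum_distrib_right)
  also have "(\<Sum>v\<in>verts G. \<Sum>e | e \<in> edges G \<and> src G e = v. of_int (germ_slope f e (at_right 0)) * \<phi> (Vertex (src G e)))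
      = (\<Sum>e\<in>edges G. of_int (germ_slope f e (at_right 0)) * \<phi> (Vertex (src G e)))"
    by (rule sum.group) (use tropical_curveD[OF G] in auto)
  also have "(\<Sum>v\<in>verts G. \<Sum>e | e \<in> edges G \<and> tgt G e = v. of_int (germ_slope f e (tgt_filter G e)) * \<phi> (Vertex (tgt G e)))
      = (\<Sum>e\<in>edges G. of_int (germ_slope f e (tgt_filter G e)) * \<phi> (Vertex (tgt G e)))"
    by (rule sum.group) (use tropical_curveD[OF G] in auto)
  finally show ?thesis by (simp add: sum.distrib sum_subtractf)
qed

end

section \<open>Principal divisors, and R(D) as a tropical semi-module\<close>

lemma lookup_principal_divisor:
  assumes G: "tropical_curve G" and f: "rational_function G f"
  shows "Poly_Mapping.lookup (principal_divisor G f) x = (if x \<in> points G then ord_at G f x else 0)"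
proof -
  obtain B where B: "breakpoints G f B" using ex_breakpoints[OF f] by blast
  let ?A = "{x \<in> points G. ord_at G f x \<noteq> 0}"
  have "Poly_Mapping.lookup (principal_divisor G f) x = (\<Sum>y\<in>?A. ord_at G f y * (if y = x then 1 else 0))"
    unfolding principal_divisor_def lookup_sum lookup_frag_cmul
    by (rule sum.cong) (auto simp: lookup_single when_def)
  also have "\<dots> = (\<Sum>y\<in>?A. if y = x then ord_at G f y else 0)"
    by (rule sum.cong) auto
  also have "\<dots> = (if x \<in> ?A then ord_at G f x else 0)"
    using finite_support[OF G B] by simp
  finally show ?thesis by auto
qed

lemma R_space_rational: "f \<in> R_space G D \<Longrightarrow> rational_function G f"
  by (simp add: R_space_def)

lemma R_space_iff:
  assumes "tropical_curve G" "is_divisor G D"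
  shows "f \<in> R_space G D \<longleftrightarrow> rational_function G f \<and>
    (\<forall>x\<in>points G. 0 \<le> Poly_Mapping.lookup D x + ord_at G f x)"
proof -
  have D0: "Poly_Mapping.lookup D x = 0" if "x \<notin> points G" for x
    using assms(2) that by (auto simp: is_divisor_def in_keys_iff)
  have "(\<forall>x. 0 \<le> Poly_Mapping.lookup D x + (if x \<in> points G then ord_at G f x else 0)) \<longleftrightarrow>
      (\<forall>x\<in>points G. 0 \<le> Poly_Mapping.lookup D x + ord_at G f x)"
    (is "?L \<longleftrightarrow> ?R")
  proof (rule iffI)
    assume L: ?L
    show ?R
    proof
      fix x assume "x \<in> points G"
      then show "0 \<le> Poly_Mapping.lookup D x + ord_at G f x" using spec[OF L, of x] by simp
    qed
  qed (auto simp: D0)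
  then show ?thesis
    by (simp add: R_space_def effective_def lookup_add lookup_principal_divisor[OF assms(1)] cong: conj_cong)
qed

lemma ord_at_add_const:
  assumes G: "tropical_curve G" and f: "rational_function G f" and x: "x \<in> points G"
  shows "ord_at G (\<lambda>x\<in>points G. a + f x) x = ord_at G f x"
proof -
  \<comment> \<open>The zero function, written as \<open>f - f\<close>, has order 0 by
    \<open>ord_at_diff\<close>; then the translate is \<open>a + (f - ?z)\<close>, and
    \<open>ord_at_diff\<close> applies again.\<close>
  let ?z = "\<lambda>x\<in>points G. f x - f x"
  have "ord_at G ?z x = ord_at G f x - ord_at G f x"
    by (rule ord_at_diff[OF G f f x, of _ 0]) simp
  moreover have "ord_at G (\<lambda>x\<in>points G. a + f x) x = ord_at G f x - ord_at G ?z x"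
    by (rule ord_at_diff[OF G f rational_function_diff[OF G f f] x, of _ a]) simp
  ultimately show ?thesis by simp
qed

lemma principal_divisor_add_const:
  assumes G: "tropical_curve G" and f: "rational_function G f"
  shows "principal_divisor G (\<lambda>x\<in>points G. a + f x) = principal_divisor G f"
  by (rule poly_mapping_eqI)
     (simp add: lookup_principal_divisor[OF G] f rational_function_add_const[OF G f] ord_at_add_const[OF G f])

lemma R_space_add_const:
  assumes G: "tropical_curve G" and f: "f \<in> R_space G D"
  shows "(\<lambda>x\<in>points G. a + f x) \<in> R_space G D"
  using f rational_function_add_const[OF G] principal_divisor_add_const[OF G]
  by (auto simp: R_space_def)

text \<open>At each point the maximum touches the larger of the two functions from above, so
  \<open>ord_at_mono\<close> bounds its order below by the order of that function.\<close>

lemma R_space_max: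
  assumes G: "tropical_curve G" and D: "is_divisor G D"
    and f: "f \<in> R_space G D" and g: "g \<in> R_space G D"
  shows "(\<lambda>x\<in>points G. max (f x) (g x)) \<in> R_space G D"
  unfolding R_space_iff[OF G D]
proof (intro conjI ballI)
  note rf = R_space_rational[OF f] and rg = R_space_rational[OF g]
  show r: "rational_function G (\<lambda>x\<in>points G. max (f x) (g x))"
    by (rule rational_function_max[OF G rf rg])
  fix x assume x: "x \<in> points G"
  have "ord_at G f x \<le> ord_at G (\<lambda>x\<in>points G. max (f x) (g x)) x" if "g x \<le> f x"
    by (rule ord_at_mono[OF G rf r]) (use x that in auto)
  moreover have "ord_at G g x \<le> ord_at G (\<lambda>x\<in>points G. max (f x) (g x)) x" if "f x \<le> g x"
    by (rule ord_at_mono[OF G rg r]) (use x that in auto)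
  moreover have "0 \<le> Poly_Mapping.lookup D x + ord_at G f x" "0 \<le> Poly_Mapping.lookup D x + ord_at G g x"
    using f g x unfolding R_space_iff[OF G D] by auto
  ultimately show "0 \<le> Poly_Mapping.lookup D x + ord_at G (\<lambda>x\<in>points G. max (f x) (g x)) x"
    by linarith
qed

lemma R_space_Max:
  assumes G: "tropical_curve G" and D: "is_divisor G D"
    and "finite I" "I \<noteq> {}" "\<And>i. i \<in> I \<Longrightarrow> g i \<in> R_space G D"
  shows "(\<lambda>x\<in>points G. Max ((\<lambda>i. g i x) ` I)) \<in> R_space G D"
  using assms(3-5)
proof (induction I rule: finite_ne_induct)
  case (singleton i)
  have "(\<lambda>x\<in>points G. g i x) = g i"
    using singleton rational_functionD(1)[OF R_space_rational] by (metis extensional_restrict insertI1)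
  then show ?case using singleton by simp
next
  case (insert i I)
  let ?h = "\<lambda>x\<in>points G. Max ((\<lambda>i. g i x) ` I)"
  have "(\<lambda>x\<in>points G. max (g i x) (?h x)) \<in> R_space G D"
    by (rule R_space_max[OF G D]) (use insert in auto)
  moreover have "(\<lambda>x\<in>points G. max (g i x) (?h x)) = (\<lambda>x\<in>points G. Max ((\<lambda>i. g i x) ` insert i I))"
    using insert by (intro restrict_ext) simp
  ultimately show ?case by (simp only:)
qed

section \<open>Injectivity of the divisor map modulo constants\<close>

text \<open>An energy argument: \<open>h\<close> is affine on each edge, and its orders summed
  against \<open>h\<close> itself give minus the total Dirichlet energy. As all orders are 0, all
  slopes vanish, and connectedness makes \<open>h\<close> constant.\<close>

lemma constant_if_no_zeros_and_poles:
  assumes G: "tropical_curve G" and h: "rational_function G h"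
    and ord: "\<And>x. x \<in> points G \<Longrightarrow> ord_at G h x = 0"
    and x: "x \<in> points G" and y: "y \<in> points G"
  shows "h x = h y"
proof -
  note cont = rational_functionD(2)[OF h]
  obtain B where B: "breakpoints G h B" using ex_breakpoints[OF h] by blast
  define m where "m e = germ_slope h e (at_right 0)" for e
  have kink: "kink (\<lambda>t. h (Inner e t)) t = 0" if "e \<in> edges G" "t \<in> edge_interior G e" for e t
    using ord[of "Inner e t"] that by (simp add: ord_at_Inner del: ord_at.simps)
  have edge: "germ_slope h e (tgt_filter G e) = m e"
      "\<exists>c. \<forall>t\<in>edge_interior G e. h (Inner e t) = of_int (m e) * t + c"
    if e: "e \<in> edges G" for e
  proof -
    interpret open_edge "edge_interior G e" "at_right 0" "tgt_filter G e"
      by (rule open_edge_interior[OF G e])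
    note * = affine_if_no_kinks[OF breakpointsD[OF B e]
        continuous_on_edge_interior[OF G cont e] kink[OF e]]
    show "germ_slope h e (tgt_filter G e) = m e"
      "\<exists>c. \<forall>t\<in>edge_interior G e. h (Inner e t) = of_int (m e) * t + c"
      using * by (simp_all add: germ_slope_eq m_def)
  qed
  \<comment> \<open>Minus the Dirichlet energy of the edge: the slope squared times the length when
    the slope is nonzero, and 0 otherwise.\<close>
  define w where "w e = of_int (m e) * (h (Vertex (src G e)) - h (Vertex (tgt G e)))" for e
  have w: "w e \<le> 0 \<and> (w e = 0 \<longrightarrow> m e = 0) \<and> (m e = 0 \<longrightarrow>
      (\<forall>t\<in>edge_interior G e. h (Inner e t) = h (Vertex (src G e)))
      \<and> h (Vertex (tgt G e)) = h (Vertex (src G e)))"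
    if e: "e \<in> edges G" for e
  proof -
    interpret open_edge "edge_interior G e" "at_right 0" "tgt_filter G e"
      by (rule open_edge_interior[OF G e])
    obtain c where c: "\<And>t. t \<in> edge_interior G e \<Longrightarrow> h (Inner e t) = of_int (m e) * t + c"
      using edge(2)[OF e] by blast
    have "((\<lambda>t. of_int (m e) * t + c) \<longlongrightarrow> of_int (m e) * 0 + c) (at_right 0)"
      by (intro tendsto_intros)
    then have "((\<lambda>t. h (Inner e t)) \<longlongrightarrow> of_int (m e) * 0 + c) (at_right 0)"
      by (rule Lim_transform_eventually) (use eventually_in_U(1) c in \<open>auto elim!: eventually_mono\<close>)
    then have src: "h (Vertex (src G e)) = c"
      using tendsto_src[OF G cont e] tendsto_unique[OF trivial_limit_at_right_real] by fastforce
    show ?thesis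
    proof (cases "m e = 0")
      case True
      have "((\<lambda>t. h (Inner e t)) \<longlongrightarrow> c) (tgt_filter G e)"
        by (rule tendsto_eventually) (use eventually_in_U(2) c True in \<open>auto elim!: eventually_mono\<close>)
      then have "h (Vertex (tgt G e)) = c"
        using tendsto_tgt[OF G cont e] tendsto_unique[OF one_sided_nontrivial[OF E]] by blast
      then show ?thesis using c src True by (simp add: w_def)
    next
      case False
      \<comment> \<open>A nonzero slope cannot persist up to a point at infinity, so this edge is
        finite.\<close>
      have "len G e \<noteq> \<infinity>"
        using has_slope_at_top_limit[of "\<lambda>t. h (Inner e t)" "m e"] rational_has_slope(2)[OF G h e]
          tendsto_tgt[OF G cont e] edge(1)[OF e] False by (auto simp: tgt_filter_def)
      then obtain L where L: "len G e = ereal L" "0 < L"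
        using tropical_curveD(6)[OF G e] by (cases "len G e") auto
      then have F: "tgt_filter G e = at_left L" by (simp add: tgt_filter_def)
      have "((\<lambda>t. of_int (m e) * t + c) \<longlongrightarrow> of_int (m e) * L + c) (tgt_filter G e)"
        unfolding F by (intro tendsto_intros)
      then have "((\<lambda>t. h (Inner e t)) \<longlongrightarrow> of_int (m e) * L + c) (tgt_filter G e)"
        by (rule Lim_transform_eventually) (use eventually_in_U(2) c in \<open>auto elim!: eventually_mono\<close>)
      then have "h (Vertex (tgt G e)) = of_int (m e) * L + c"
        using tendsto_tgt[OF G cont e] tendsto_unique[OF one_sided_nontrivial[OF E]] by blast
      then have "w e = - ((of_int (m e))\<^sup>2 * L)" by (simp add: w_def src power2_eq_square)
      moreover have "0 < (of_int (m e))\<^sup>2 * L" using False L by simp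
      ultimately show ?thesis using False L(2) by simp
    qed
  qed
  have "(\<Sum>e\<in>edges G. w e) = 0"
  proof -
    have "0 = (\<Sum>x | x \<in> points G \<and> ord_at G h x \<noteq> 0. of_int (ord_at G h x) * h x)"
      using ord by (intro sum.neutral[symmetric]) auto
    also have "\<dots> = (\<Sum>e\<in>edges G. w e)"
      unfolding sum_ord[OF G B]
    proof (rule sum.cong)
      fix e assume e: "e \<in> edges G"
      have "(\<Sum>t\<in>B e. of_int (kink (\<lambda>t. h (Inner e t)) t) * h (Inner e t)) = 0"
        using kink[OF e] breakpointsD(2)[OF B e] by (intro sum.neutral) auto
      then show "(\<Sum>t\<in>B e. of_int (kink (\<lambda>t. h (Inner e t)) t) * h (Inner e t)) +
          of_int (germ_slope h e (at_right 0)) * h (Vertex (src G e)) -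
          of_int (germ_slope h e (tgt_filter G e)) * h (Vertex (tgt G e)) = w e"
        by (simp add: w_def edge(1)[OF e] m_def[symmetric] algebra_simps)
    qed simp
    finally show ?thesis by simp
  qed
  then have "w e = 0" if "e \<in> edges G" for e
    using sum_nonneg_eq_0_iff[OF tropical_curveD(3)[OF G], of "\<lambda>e. - w e"] w that
    by (simp add: sum_negf)
  then have const: "h (edge_map G e s) = h (Vertex (src G e))"
    if "e \<in> edges G" "s \<in> {0..len G e}" for e s
  proof -
    have "\<forall>t\<in>edge_interior G e. h (Inner e t) = h (Vertex (src G e))"
      and "h (Vertex (tgt G e)) = h (Vertex (src G e))"
      using w[OF that(1)] \<open>\<And>e. e \<in> edges G \<Longrightarrow> w e = 0\<close>[OF that(1)] by blast+
    with that(2) show ?thesis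
      by (cases rule: edge_parameter_cases)
         (auto simp: edge_map_interior edge_map_len[OF tropical_curveD(6)[OF G that(1)]])
  qed
  \<comment> \<open>As \<open>h\<close> is constant on every closed edge, both a level set and its
    complement are open in the curve.\<close>
  have op: "openin (curve_topology G) {z \<in> points G. P (h z)}" for P
    unfolding openin_curve_topology
  proof (intro conjI ballI)
    fix e assume e: "e \<in> edges G"
    have "{s \<in> {0..len G e}. edge_map G e s \<in> {z \<in> points G. P (h z)}} =
        (if P (h (Vertex (src G e))) then {0..len G e} else {})"
      using edge_map_in_points[OF G e] const[OF e] by auto
    then show "openin (top_of_set {0..len G e})
        {s \<in> {0..len G e}. edge_map G e s \<in> {z \<in> points G. P (h z)}}" by simp
  qed auto
  show ?thesis
  proof (rule ccontr)
    assume "h x \<noteq> h y"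
    then have "x \<in> {z \<in> points G. h z = h x}" "y \<in> {z \<in> points G. h z \<noteq> h x}"
      using x y by auto
    moreover have "points G \<subseteq> {z \<in> points G. h z = h x} \<union> {z \<in> points G. h z \<noteq> h x}"
      "{z \<in> points G. h z = h x} \<inter> {z \<in> points G. h z \<noteq> h x} = {}" by auto
    ultimately show False
      using tropical_curveD(7)[OF G] op[of "\<lambda>r. r = h x"] op[of "\<lambda>r. r \<noteq> h x"]
      unfolding connected_space_def topspace_curve_topology[OF G] by blast
  qed
qed

lemma based_at_eq_if_principal_divisor_eq:
  assumes G: "tropical_curve G" and f: "rational_function G f" and g: "rational_function G g"
    and eq: "principal_divisor G f = principal_divisor G g" and x0: "x0 \<in> points G"
  shows "based_at (points G) x0 f = based_at (points G) x0 g"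
proof -
  let ?h = "\<lambda>x\<in>points G. f x - g x"
  have "?h x = ?h x0" if x: "x \<in> points G" for x
  proof (rule constant_if_no_zeros_and_poles[OF G rational_function_diff[OF G f g] _ x x0])
    fix y assume y: "y \<in> points G"
    have "ord_at G f y = ord_at G g y"
      using y eq lookup_principal_divisor[OF G f, of y] lookup_principal_divisor[OF G g, of y] by simp
    then show "ord_at G ?h y = 0"
      using ord_at_diff[OF G f g y, of ?h 0] by simp
  qed
  then show ?thesis using x0 by (auto simp: based_at_def restrict_def fun_eq_iff algebra_simps)
qed

section \<open>Test functions\<close>

definition divisor_sum :: "('a \<Rightarrow> real) \<Rightarrow> ('a \<Rightarrow>\<^sub>0 int) \<Rightarrow> real" where
  "divisor_sum \<phi> E = (\<Sum>x\<in>Poly_Mapping.keys E. of_int (Poly_Mapping.lookup E x) * \<phi> x)"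

lemma divisor_sum_superset:
  assumes "finite A" "Poly_Mapping.keys E \<subseteq> A"
  shows "divisor_sum \<phi> E = (\<Sum>x\<in>A. of_int (Poly_Mapping.lookup E x) * \<phi> x)"
  unfolding divisor_sum_def
  by (rule sum.mono_neutral_left) (use assms in \<open>auto simp: in_keys_iff\<close>)

lemma divisor_sum_add: "divisor_sum \<phi> (E + E') = divisor_sum \<phi> E + divisor_sum \<phi> E'"
proof -
  let ?A = "Poly_Mapping.keys E \<union> Poly_Mapping.keys E'"
  have "divisor_sum \<phi> (E + E') = (\<Sum>x\<in>?A. of_int (Poly_Mapping.lookup (E + E') x) * \<phi> x)"
    by (rule divisor_sum_superset) (simp_all add: keys_add)
  also have "\<dots> = divisor_sum \<phi> E + divisor_sum \<phi> E'"
    by (simp add: divisor_sum_superset[of ?A] lookup_add distrib_right sum.distrib)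
  finally show ?thesis .
qed

lemma divisor_sum_0 [simp]: "divisor_sum \<phi> 0 = 0"
  by (simp add: divisor_sum_def)

lemma divisor_sum_frag_of [simp]: "divisor_sum \<phi> (frag_of x) = \<phi> x"
  by (simp add: divisor_sum_def)

lemma divisor_sum_sum: "divisor_sum \<phi> (\<Sum>i\<in>I. E i) = (\<Sum>i\<in>I. divisor_sum \<phi> (E i))"
  by (induction I rule: infinite_finite_induct) (auto simp: divisor_sum_add)

lemma divisor_sum_principal_divisor:
  assumes G: "tropical_curve G" and f: "rational_function G f"
  shows "divisor_sum \<phi> (principal_divisor G f) =
    (\<Sum>x | x \<in> points G \<and> ord_at G f x \<noteq> 0. of_int (ord_at G f x) * \<phi> x)"
proof -
  have "Poly_Mapping.keys (principal_divisor G f) = {x \<in> points G. ord_at G f x \<noteq> 0}"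
    by (auto simp: in_keys_iff lookup_principal_divisor[OF G f] split: if_splits)
  then show ?thesis
    unfolding divisor_sum_def by (intro sum.cong) (auto simp: lookup_principal_divisor[OF G f])
qed

text \<open>The second clause asks that pairing with the divisor of \<open>f\<close> depend on
  \<open>f\<close> continuously under pointwise convergence, although the divisor is built from
  slopes. \<Lambda> lives on the whole power of the reals, so that its continuity can be restricted
  to any set of rational functions.\<close>

definition test_function :: "('v, 'e) metric_graph \<Rightarrow> (('v, 'e) point \<Rightarrow> real) \<Rightarrow> bool" where
  "test_function G \<phi> \<longleftrightarrow> continuous_map (curve_topology G) euclideanreal \<phi> \<and>
     (\<exists>\<Lambda>. continuous_map (powertop_real (points G)) euclideanreal \<Lambda> \<and>
       (\<forall>f. rational_function G f \<longrightarrow> divisor_sum \<phi> (principal_divisor G f) = \<Lambda> f))"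

fun piecewise_affine ::
    "('v, 'e) metric_graph \<Rightarrow> ('v \<Rightarrow> real) \<Rightarrow> ('e \<Rightarrow> real \<Rightarrow> real) \<Rightarrow> ('v, 'e) point \<Rightarrow> real" where
  "piecewise_affine G \<gamma> \<psi> (Vertex v) = \<gamma> v"
| "piecewise_affine G \<gamma> \<psi> (Inner e t) = \<gamma> (src G e) + \<psi> e t"

text \<open>Two ramps per edge serve both kinds of points to be separated: they lead from one vertex
  value to 0 and on to the other, or rise and fall around an inner point. As they lie strictly
  inside the edge, the function is constant near both ends, which gives continuity at infinity and
  leaves only values of \<open>f\<close> at inner points. The condition \<open>tgt\<close> makes the
  values at the target end fit.\<close>

context
  fixes G :: "('v, 'e) metric_graph" and \<gamma> :: "'v \<Rightarrow> real"
    and a b c d \<alpha> \<beta> :: "'e \<Rightarrow> real" and \<phi> :: "('v, 'e) point \<Rightarrow> real"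
  assumes G: "tropical_curve G"
    and ab: "\<And>e. e \<in> edges G \<Longrightarrow> a e \<in> edge_interior G e \<and> b e \<in> edge_interior G e \<and> a e < b e"
    and cd: "\<And>e. e \<in> edges G \<Longrightarrow> c e \<in> edge_interior G e \<and> d e \<in> edge_interior G e \<and> c e < d e"
    and tgt: "\<And>e. e \<in> edges G \<Longrightarrow> \<gamma> (tgt G e) = \<gamma> (src G e) + \<alpha> e + \<beta> e"
  defines "\<phi> \<equiv> piecewise_affine G \<gamma> (\<lambda>e t. \<alpha> e * ramp (a e) (b e) t + \<beta> e * ramp (c e) (d e) t)"
begin

text \<open>The second derivative moves from \<open>f\<close> to the piecewise affine function, whose kinks are
  \<open>a e\<close>, \<open>b e\<close>, \<open>c e\<close> and \<open>d e\<close> and do not depend on \<open>f\<close>.\<close>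

lemma divisor_sum_piecewise_affine:
  assumes f: "rational_function G f"
  shows "divisor_sum \<phi> (principal_divisor G f) =
    (\<Sum>e\<in>edges G. - (\<alpha> e / (b e - a e)) * (f (Inner e (b e)) - f (Inner e (a e)))
                  - (\<beta> e / (d e - c e)) * (f (Inner e (d e)) - f (Inner e (c e))))"
proof -
  obtain B where B: "breakpoints G f B" using ex_breakpoints[OF f] by blast
  show ?thesis
    unfolding divisor_sum_principal_divisor[OF G f] sum_ord[OF G B]
  proof (rule sum.cong)
    fix e assume e: "e \<in> edges G"
    interpret open_edge "edge_interior G e" "at_right 0" "tgt_filter G e"
      by (rule open_edge_interior[OF G e])
    let ?h = "\<lambda>t. f (Inner e t)"
    note h = breakpointsD[OF B e] continuous_on_edge_interior[OF G rational_functionD(2)[OF f] e]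
    have "(\<Sum>t\<in>B e. of_int (kink ?h t) * \<phi> (Inner e t)) =
        \<gamma> (src G e) * of_int (\<Sum>t\<in>B e. kink ?h t)
        + \<alpha> e * (\<Sum>t\<in>B e. of_int (kink ?h t) * ramp (a e) (b e) t)
        + \<beta> e * (\<Sum>t\<in>B e. of_int (kink ?h t) * ramp (c e) (d e) t)"
      by (simp add: \<phi>_def sum_distrib_left sum.distrib algebra_simps)
    also have "\<dots> = \<gamma> (src G e) * of_int (germ_slope f e (tgt_filter G e) - germ_slope f e (at_right 0))
        + \<alpha> e * (of_int (germ_slope f e (tgt_filter G e)) - (?h (b e) - ?h (a e)) / (b e - a e))
        + \<beta> e * (of_int (germ_slope f e (tgt_filter G e)) - (?h (d e) - ?h (c e)) / (d e - c e))"
      using ab[OF e] cd[OF e]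
      by (simp add: sum_kink[OF h] sum_kink_ramp[OF h] germ_slope_eq del: of_int_sum)
    finally have kinks: "(\<Sum>t\<in>B e. of_int (kink ?h t) * \<phi> (Inner e t)) =
        \<gamma> (src G e) * of_int (germ_slope f e (tgt_filter G e) - germ_slope f e (at_right 0))
        + \<alpha> e * (of_int (germ_slope f e (tgt_filter G e)) - (?h (b e) - ?h (a e)) / (b e - a e))
        + \<beta> e * (of_int (germ_slope f e (tgt_filter G e)) - (?h (d e) - ?h (c e)) / (d e - c e))" .
    \<comment> \<open>In \<open>kinks\<close> the end slope is multiplied by the value at the target
      and the start slope by minus the value at the source, so the vertex terms cancel both.\<close>
    have ends: "\<phi> (Vertex (src G e)) = \<gamma> (src G e)" "\<phi> (Vertex (tgt G e)) = \<gamma> (src G e) + \<alpha> e + \<beta> e"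
      by (simp_all add: \<phi>_def tgt[OF e])
    show "(\<Sum>t\<in>B e. of_int (kink ?h t) * \<phi> (Inner e t))
        + of_int (germ_slope f e (at_right 0)) * \<phi> (Vertex (src G e))
        - of_int (germ_slope f e (tgt_filter G e)) * \<phi> (Vertex (tgt G e)) =
        - (\<alpha> e / (b e - a e)) * (?h (b e) - ?h (a e)) - (\<beta> e / (d e - c e)) * (?h (d e) - ?h (c e))"
      unfolding kinks ends by (simp add: algebra_simps diff_divide_distrib)
  qed simp
qed

lemma continuous_map_piecewise_affine: "continuous_map (curve_topology G) euclideanreal \<phi>"
  unfolding continuous_map_curve[OF G]
proof
  fix e assume e: "e \<in> edges G"
  define T where "T = max (b e) (d e)"
  have T: "T \<in> edge_interior G e" and bd: "b e \<le> T" "d e \<le> T"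
    using ab[OF e] cd[OF e] by (auto simp: T_def max_def)
  define \<psi> where "\<psi> t = \<gamma> (src G e) + (\<alpha> e * ramp (a e) (b e) t + \<beta> e * ramp (c e) (d e) t)" for t
  \<comment> \<open>Both ramps are constant beyond \<open>T\<close>, so cutting the parameter off at
    \<open>T\<close> makes it real without changing the function.\<close>
  define \<kappa> where "\<kappa> s = real_of_ereal (min s (ereal T))" for s
  have "continuous_on {0..len G e} \<kappa>"
    unfolding \<kappa>_def
  proof (rule continuous_on_compose2[OF continuous_on_real])
    show "continuous_on {0..len G e} (\<lambda>s. min s (ereal T))" by (intro continuous_intros)
    show "(\<lambda>s. min s (ereal T)) ` {0..len G e} \<subseteq> UNIV - {\<infinity>, - \<infinity>}"
      using T by (auto simp: min_def edge_interior_def split: if_splits)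
  qed
  moreover have "continuous_on UNIV \<psi>"
    unfolding \<psi>_def using ab[OF e] cd[OF e] by (intro continuous_intros continuous_on_ramp) auto
  ultimately have cont: "continuous_on {0..len G e} (\<lambda>s. \<psi> (\<kappa> s))"
    by (auto intro: continuous_on_compose2)
  have "\<psi> (\<kappa> s) = \<phi> (edge_map G e s)" if "s \<in> {0..len G e}" for s
    using that
  proof (cases rule: edge_parameter_cases)
    case 1
    then show ?thesis using T ab[OF e] cd[OF e]
      by (simp add: \<kappa>_def \<psi>_def \<phi>_def min_def edge_interior_def zero_ereal_def[symmetric])
  next
    case 2
    then have "\<kappa> s = T" using T by (simp add: \<kappa>_def min_absorb2 edge_interior_def)
    then show ?thesis
      using 2 bd ab[OF e] cd[OF e] tropical_curveD(6)[OF G e] tgt[OF e]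
      by (simp add: \<psi>_def \<phi>_def edge_map_len)
  next
    case (3 t)
    then have "\<kappa> s = min t T" by (simp add: \<kappa>_def min_def)
    moreover have "\<psi> (min t T) = \<psi> t"
      using bd ab[OF e] cd[OF e] by (auto simp: \<psi>_def min_def)
    ultimately show ?thesis using 3 by (simp add: edge_map_interior \<phi>_def \<psi>_def)
  qed
  with cont show "continuous_on {0..len G e} (\<lambda>s. \<phi> (edge_map G e s))"
    by (rule continuous_on_eq)
qed

lemma test_function_piecewise_affine: "test_function G \<phi>"
  unfolding test_function_def
proof (intro conjI exI allI impI)
  show "continuous_map (powertop_real (points G)) euclideanreal
    (\<lambda>f. \<Sum>e\<in>edges G. - (\<alpha> e / (b e - a e)) * (f (Inner e (b e)) - f (Inner e (a e)))
                  - (\<beta> e / (d e - c e)) * (f (Inner e (d e)) - f (Inner e (c e))))"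
    using ab cd
    by (intro continuous_map_sum continuous_map_diff continuous_map_real_mult_left
        continuous_map_product_projection tropical_curveD(3)[OF G]) auto
qed (rule continuous_map_piecewise_affine divisor_sum_piecewise_affine; assumption?)+

end

text \<open>The points of \<open>A\<close> on an edge are left in the middle, where the first ramp
  has ended and the second has not begun. On an edge without such points the two ramps may
  overlap.\<close>

lemma ex_ramp_supports:
  assumes G: "tropical_curve G" and A: "finite A"
  obtains a b c d where
    "\<And>e. e \<in> edges G \<Longrightarrow> a e \<in> edge_interior G e \<and> b e \<in> edge_interior G e \<and> a e < b e"
    "\<And>e. e \<in> edges G \<Longrightarrow> c e \<in> edge_interior G e \<and> d e \<in> edge_interior G e \<and> c e < d e"
    "\<And>e t. e \<in> edges G \<Longrightarrow> Inner e t \<in> A \<Longrightarrow> t \<in> edge_interior G e \<Longrightarrow> b e \<le> t \<and> t \<le> c e"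
proof -
  have "\<forall>e\<in>edges G. \<exists>a b c d. a \<in> edge_interior G e \<and> b \<in> edge_interior G e \<and> a < b \<and>
      c \<in> edge_interior G e \<and> d \<in> edge_interior G e \<and> c < d \<and>
      (\<forall>t\<in>edge_interior G e. Inner e t \<in> A \<longrightarrow> b \<le> t \<and> t \<le> c)"
  proof
    fix e assume e: "e \<in> edges G"
    interpret open_edge "edge_interior G e" "at_right 0" "tgt_filter G e"
      by (rule open_edge_interior[OF G e])
    have "finite (Inner e -` A)" using A by (intro finite_vimageI) (auto simp: inj_on_def)
    then obtain b c where b: "b \<in> edge_interior G e" "\<forall>t\<in>Inner e -` A \<inter> edge_interior G e. b < t"
      and c: "c \<in> edge_interior G e" "\<forall>t\<in>Inner e -` A \<inter> edge_interior G e. t < c"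
      using ex_below ex_above by meson
    obtain a where a: "a \<in> edge_interior G e" "a < b" using ex_below[of "{b}"] b by auto
    obtain d where d: "d \<in> edge_interior G e" "c < d" using ex_above[of "{c}"] c by auto
    show "\<exists>a b c d. a \<in> edge_interior G e \<and> b \<in> edge_interior G e \<and> a < b \<and>
      c \<in> edge_interior G e \<and> d \<in> edge_interior G e \<and> c < d \<and>
      (\<forall>t\<in>edge_interior G e. Inner e t \<in> A \<longrightarrow> b \<le> t \<and> t \<le> c)"
      using a b c d by (intro exI[of _ a] exI[of _ b] exI[of _ c] exI[of _ d]) (auto intro: less_imp_le)
  qed
  then show ?thesis
    using that unfolding bchoice_iff by metis
qed

lemma test_function_separates:
  assumes G: "tropical_curve G" and A: "finite A" "A \<subseteq> points G" and x: "x \<in> points G" "x \<notin> A"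
  shows "\<exists>\<phi>. test_function G \<phi> \<and> \<phi> x = 1 \<and> (\<forall>y\<in>A. \<phi> y = 0)"
proof -
  obtain a b c d where ab: "\<And>e. e \<in> edges G \<Longrightarrow> a e \<in> edge_interior G e \<and> b e \<in> edge_interior G e \<and> a e < b e"
    and cd: "\<And>e. e \<in> edges G \<Longrightarrow> c e \<in> edge_interior G e \<and> d e \<in> edge_interior G e \<and> c e < d e"
    and avoid: "\<And>e t. e \<in> edges G \<Longrightarrow> Inner e t \<in> A \<Longrightarrow> t \<in> edge_interior G e \<Longrightarrow> b e \<le> t \<and> t \<le> c e"
    using ex_ramp_supports[OF G A(1)] by (metis (no_types))
  show ?thesis
  proof (cases x)
    case (Vertex v)
    define \<gamma> :: "'a \<Rightarrow> real" where "\<gamma> w = (if w = v then 1 else 0)" for w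
    \<comment> \<open>The value 1 at \<open>v\<close> falls to 0 before the points of
      \<open>A\<close> on an outgoing edge and is regained after them on an incoming edge; a loop at
      \<open>v\<close> does both.\<close>
    let ?\<phi> = "piecewise_affine G \<gamma> (\<lambda>e t. - \<gamma> (src G e) * ramp (a e) (b e) t + \<gamma> (tgt G e) * ramp (c e) (d e) t)"
    have "test_function G ?\<phi>"
      by (rule test_function_piecewise_affine[OF G ab cd]) auto
    moreover have "?\<phi> y = 0" if y: "y \<in> A" for y
    proof (cases y)
      case (Inner e t)
      then have "e \<in> edges G" "t \<in> edge_interior G e" "b e \<le> t \<and> t \<le> c e"
        using y A avoid by auto
      then show ?thesis using ab cd by (simp add: Inner)
    qed (use y x Vertex in \<open>auto simp: \<gamma>_def\<close>)
    ultimately show ?thesis by (intro exI[of _ ?\<phi>]) (auto simp: Vertex \<gamma>_def)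
  next
    case (Inner e0 p)
    then have e0: "e0 \<in> edges G" and p: "p \<in> edge_interior G e0" using x by auto
    interpret open_edge "edge_interior G e0" "at_right 0" "tgt_filter G e0"
      by (rule open_edge_interior[OF G e0])
    have "finite (Inner e0 -` A)" using A by (intro finite_vimageI) (auto simp: inj_on_def)
    then have "open (edge_interior G e0 - Inner e0 -` A)"
      using open_U by (intro open_Diff finite_imp_closed)
    moreover have "p \<in> edge_interior G e0 - Inner e0 -` A" using p x Inner by auto
    ultimately obtain \<epsilon> where \<epsilon>: "\<epsilon> > 0" "cball p \<epsilon> \<subseteq> edge_interior G e0 - Inner e0 -` A"
      using open_contains_cball by metis
    have near: "t \<in> edge_interior G e0 \<and> Inner e0 t \<notin> A" if "p - \<epsilon> \<le> t" "t \<le> p + \<epsilon>" for t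
      using subsetD[OF \<epsilon>(2), of t] that by (auto simp: dist_real_def)
    \<comment> \<open>On \<open>e0\<close> the ramps form a trapezoid that is 1 within \<epsilon>/2
      of \<open>p\<close> and 0 beyond \<epsilon>. On the other edges the coefficients are 0, and
      the old parameters are kept only to have admissible ones.\<close>
    define a' b' c' d' where "a' = a(e0 := p - \<epsilon>)" and "b' = b(e0 := p - \<epsilon>/2)"
      and "c' = c(e0 := p + \<epsilon>/2)" and "d' = d(e0 := p + \<epsilon>)"
    define \<alpha> :: "'b \<Rightarrow> real" where "\<alpha> e = (if e = e0 then 1 else 0)" for e
    let ?\<phi> = "piecewise_affine G (\<lambda>_. 0) (\<lambda>e t. \<alpha> e * ramp (a' e) (b' e) t + - \<alpha> e * ramp (c' e) (d' e) t)"
    have "test_function G ?\<phi>"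
    proof (rule test_function_piecewise_affine[OF G])
      show "a' e \<in> edge_interior G e \<and> b' e \<in> edge_interior G e \<and> a' e < b' e" if "e \<in> edges G" for e
        using ab[OF that] near \<epsilon>(1) by (auto simp: a'_def b'_def)
      show "c' e \<in> edge_interior G e \<and> d' e \<in> edge_interior G e \<and> c' e < d' e" if "e \<in> edges G" for e
        using cd[OF that] near \<epsilon>(1) by (auto simp: c'_def d'_def)
    qed auto
    moreover have "?\<phi> y = 0" if y: "y \<in> A" for y
    proof (cases y)
      case (Inner e t)
      have "t \<le> p - \<epsilon> \<or> p + \<epsilon> \<le> t" if "e = e0"
        using near[of t] y Inner that by force
      then show ?thesis using Inner \<epsilon>(1) by (auto simp: \<alpha>_def a'_def b'_def c'_def d'_def)
    qed simp
    moreover have "?\<phi> x = 1" using \<epsilon>(1) by (simp add: Inner \<alpha>_def a'_def b'_def c'_def d'_def)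
    ultimately show ?thesis by blast
  qed
qed

text \<open>A test function that is 1 at \<open>x\<close> and 0 at all other points of both supports
  reads off the coefficient at \<open>x\<close>.\<close>

lemma divisor_eq_if_divisor_sums_eq:
  assumes G: "tropical_curve G" and E: "Poly_Mapping.keys E \<subseteq> points G" "Poly_Mapping.keys E' \<subseteq> points G"
    and eq: "\<And>\<phi>. test_function G \<phi> \<Longrightarrow> divisor_sum \<phi> E = divisor_sum \<phi> E'"
  shows "E = E'"
proof (rule poly_mapping_eqI)
  fix x
  let ?K = "Poly_Mapping.keys E \<union> Poly_Mapping.keys E'"
  show "Poly_Mapping.lookup E x = Poly_Mapping.lookup E' x"
  proof (cases "x \<in> ?K")
    case True
    have x: "x \<in> points G" and K: "?K - {x} \<subseteq> points G" using E True by auto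
    obtain \<phi> where \<phi>: "test_function G \<phi>" "\<phi> x = 1" "\<forall>y\<in>?K - {x}. \<phi> y = 0"
      using test_function_separates[OF G _ K x] by auto
    have "divisor_sum \<phi> C = of_int (Poly_Mapping.lookup C x)" if "Poly_Mapping.keys C \<subseteq> ?K" for C
    proof -
      have "divisor_sum \<phi> C = (\<Sum>y\<in>?K. of_int (Poly_Mapping.lookup C y) * \<phi> y)"
        by (rule divisor_sum_superset[OF _ that]) simp
      also have "\<dots> = of_int (Poly_Mapping.lookup C x) * \<phi> x + (\<Sum>y\<in>?K - {x}. of_int (Poly_Mapping.lookup C y) * \<phi> y)"
        by (rule sum.remove) (use True in auto)
      also have "(\<Sum>y\<in>?K - {x}. of_int (Poly_Mapping.lookup C y) * \<phi> y) = 0"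
        using \<phi>(3) by (intro sum.neutral) auto
      finally show ?thesis using \<phi>(2) by simp
    qed
    then show ?thesis using eq[OF \<phi>(1)] by simp
  qed (auto simp: in_keys_iff)
qed

text \<open>On each edge the kinks add up to the difference of the end slopes, which cancels the two
  vertex terms.\<close>

lemma degree_principal_divisor:
  assumes G: "tropical_curve G" and f: "rational_function G f"
  shows "divisor_sum (\<lambda>_. 1) (principal_divisor G f) = 0"
proof -
  obtain B where B: "breakpoints G f B" using ex_breakpoints[OF f] by blast
  show ?thesis
    unfolding divisor_sum_principal_divisor[OF G f] sum_ord[OF G B]
  proof (intro sum.neutral ballI)
    fix e assume e: "e \<in> edges G"
    interpret open_edge "edge_interior G e" "at_right 0" "tgt_filter G e"
      by (rule open_edge_interior[OF G e])
    note sum_kink[OF breakpointsD[OF B e] continuous_on_edge_interior[OF G rational_functionD(2)[OF f] e]]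
    then show "(\<Sum>t\<in>B e. of_int (kink (\<lambda>t. f (Inner e t)) t) * 1)
        + of_int (germ_slope f e (at_right 0)) * 1 - of_int (germ_slope f e (tgt_filter G e)) * 1 = (0::real)"
      by (simp add: germ_slope_eq flip: of_int_sum)
  qed
qed

section \<open>The symmetric product\<close>

lemma compact_space_sym_product:
  assumes "compact_space X"
  shows "compact_space (sym_product X d)"
proof -
  let ?P = "product_topology (\<lambda>_. X) {..<d}" and ?q = "\<lambda>p. \<Sum>i<d. frag_of (p i)"
  have "compact_space ?P" using assms by (simp add: compact_space_product_topology)
  then have "compactin (sym_product X d) (?q ` topspace ?P)"
    unfolding sym_product_def compact_space_def
    using image_compactin quotient_imp_continuous_map[OF quotient_map_quotient_topology] by blast
  then show ?thesis by (simp add: compact_space_def sym_product_def)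
qed

lemma topspace_sym_product:
  "topspace (sym_product X d) = (\<lambda>p. \<Sum>i<d. frag_of (p i)) ` ({..<d} \<rightarrow>\<^sub>E topspace X)"
  by (simp add: sym_product_def)

lemma keys_sym_product:
  assumes "E \<in> topspace (sym_product X d)"
  shows "Poly_Mapping.keys E \<subseteq> topspace X"
proof -
  obtain p where p: "p \<in> {..<d} \<rightarrow>\<^sub>E topspace X" "E = (\<Sum>i<d. frag_of (p i))"
    using assms by (auto simp: topspace_sym_product)
  have "Poly_Mapping.keys E \<subseteq> (\<Union>i\<in>{..<d}. Poly_Mapping.keys (frag_of (p i)))"
    unfolding p(2) by (rule keys_sum)
  then show ?thesis using p(1) by (auto simp: keys_frag_of)
qed

text \<open>One point of the support is split off at a time. In degree 0 the nonnegative
  coefficients sum to 0 and hence all vanish.\<close>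

lemma effective_in_sym_product:
  assumes "effective E" "Poly_Mapping.keys E \<subseteq> topspace X" "divisor_sum (\<lambda>_. 1) E = real d"
  shows "E \<in> topspace (sym_product X d)"
  using assms
proof (induction d arbitrary: E)
  case 0
  have "Poly_Mapping.lookup E x = 0" for x
  proof (rule ccontr)
    assume "Poly_Mapping.lookup E x \<noteq> 0"
    then have "x \<in> Poly_Mapping.keys E" by (simp add: in_keys_iff)
    moreover have "\<forall>y\<in>Poly_Mapping.keys E. real_of_int (Poly_Mapping.lookup E y) = 0"
      using 0 by (subst sum_nonneg_eq_0_iff[symmetric]) (auto simp: divisor_sum_def effective_def)
    ultimately show False by (auto simp: in_keys_iff)
  qed
  then have "E = 0" by (intro poly_mapping_eqI) simp
  then show ?case by (simp add: topspace_sym_product)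
next
  case (Suc d)
  have "Poly_Mapping.keys E \<noteq> {}" using Suc.prems(3) by (auto simp: divisor_sum_def)
  then obtain x where x: "x \<in> Poly_Mapping.keys E" by blast
  then have x1: "1 \<le> Poly_Mapping.lookup E x"
    using Suc.prems(1) unfolding effective_def in_keys_iff by (metis int_one_le_iff_zero_less order_less_le)
  let ?E = "E - frag_of x"
  have lookup: "Poly_Mapping.lookup ?E y = Poly_Mapping.lookup E y - (if y = x then 1 else 0)" for y
    by (simp add: lookup_minus lookup_single when_def)
  have "?E \<in> topspace (sym_product X d)"
  proof (rule Suc.IH)
    show "effective ?E" using Suc.prems(1) x1 by (simp add: effective_def lookup)
    show "Poly_Mapping.keys ?E \<subseteq> topspace X"
      using Suc.prems(2) x by (auto simp: in_keys_iff lookup split: if_splits)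
    have "E = ?E + frag_of x" by simp
    then have "divisor_sum (\<lambda>_. 1) E = divisor_sum (\<lambda>_. 1) ?E + 1"
      by (metis divisor_sum_add divisor_sum_frag_of)
    then show "divisor_sum (\<lambda>_. 1) ?E = real d" using Suc.prems(3) by simp
  qed
  then obtain p where p: "p \<in> {..<d} \<rightarrow>\<^sub>E topspace X" "?E = (\<Sum>i<d. frag_of (p i))"
    by (auto simp: topspace_sym_product)
  have "E = (\<Sum>i<Suc d. frag_of ((p(d := x)) i))"
    using p(2) by (simp add: diff_eq_eq)
  moreover have "p(d := x) \<in> {..<Suc d} \<rightarrow>\<^sub>E topspace X"
    using p(1) x Suc.prems(2) by (auto simp: PiE_iff extensional_def less_Suc_eq)
  ultimately show ?case unfolding topspace_sym_product by blast
qed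

text \<open>Continuity on the quotient is tested on the product, where the pairing is the sum of the
  values of \<phi> at the coordinates.\<close>

lemma continuous_map_divisor_sum:
  assumes "continuous_map X euclideanreal \<phi>"
  shows "continuous_map (sym_product X d) euclideanreal (divisor_sum \<phi>)"
proof -
  let ?q = "\<lambda>p. \<Sum>i<d. frag_of (p i)"
  have "continuous_map (product_topology (\<lambda>_. X) {..<d}) euclideanreal (\<lambda>p. \<Sum>i<d. \<phi> (p i))"
  proof (intro continuous_map_sum)
    fix i assume "i \<in> {..<d}"
    then have "continuous_map (product_topology (\<lambda>_. X) {..<d}) X (\<lambda>p. p i)"
      by (rule continuous_map_product_projection)
    from continuous_map_compose[OF this assms]
    show "continuous_map (product_topology (\<lambda>_. X) {..<d}) euclideanreal (\<lambda>p. \<phi> (p i))"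
      by (simp add: o_def)
  qed simp
  moreover have "divisor_sum \<phi> \<circ> ?q = (\<lambda>p. \<Sum>i<d. \<phi> (p i))"
    by (auto simp: divisor_sum_sum)
  ultimately show ?thesis
    unfolding sym_product_def
    by (subst continuous_compose_quotient_map_eq[OF quotient_map_quotient_topology, symmetric]) simp
qed

text \<open>The compact ambient space is embedded as a whole and the embedding is then restricted to
  \<open>Y\<close>. So the linear system can be embedded before it is known to be compact.\<close>

lemma homeomorphic_map_from_compact_subset:
  assumes "compact_space X" "Hausdorff_space Z" "continuous_map X Z f" "inj_on f (topspace X)"
    and "Y \<subseteq> topspace X"
  shows "homeomorphic_map (subtopology X Y) (subtopology Z (f ` Y)) f"
proof -
  have im: "f ` topspace X \<subseteq> topspace Z" using assms(3) by (auto simp: continuous_map_def)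
  have "homeomorphic_map X (subtopology Z (f ` topspace X)) f"
  proof (rule continuous_imp_homeomorphic_map)
    show "continuous_map X (subtopology Z (f ` topspace X)) f"
      using assms(3) by (simp add: continuous_map_in_subtopology)
  qed (use assms im Hausdorff_space_subtopology in auto)
  then have "homeomorphic_map (subtopology X Y) (subtopology (subtopology Z (f ` topspace X)) (f ` Y)) f"
    by (rule homeomorphic_map_subtopologies) (use assms(5) im in auto)
  moreover have "f ` topspace X \<inter> f ` Y = f ` Y" using assms(5) by blast
  ultimately show ?thesis by (simp add: subtopology_subtopology)
qed

text \<open>Both spaces are embedded in the product of copies of the reals indexed by the test functions,
  with the same image.\<close>

lemma linear_system_homeomorphic_based_R_space:
  assumes G: "tropical_curve G" and D: "is_divisor G D" and x0: "x0 \<in> points G"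
    and compact: "compact_space (subtopology (powertop_real (points G)) (based_at (points G) x0 ` R_space G D))"
  shows "linear_system_topology G D homeomorphic_space
    subtopology (powertop_real (points G)) (based_at (points G) x0 ` R_space G D)"
proof -
  let ?R = "based_at (points G) x0 ` R_space G D"
  let ?S = "sym_product (curve_topology G) (nat (div_degree D))"
  define \<T> where "\<T> = Collect (test_function G)"
  define \<Phi> where "\<Phi> E = (\<lambda>\<phi>\<in>\<T>. divisor_sum \<phi> E)" for E
  define \<delta> where "\<delta> f = D + principal_divisor G f" for f
  have cont_\<Phi>: "continuous_map ?S (powertop_real \<T>) \<Phi>"
    unfolding continuous_map_componentwise
  proof (intro conjI ballI)
    fix \<phi> assume \<phi>: "\<phi> \<in> \<T>"
    then have "continuous_map ?S euclideanreal (divisor_sum \<phi>)"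
      by (intro continuous_map_divisor_sum) (simp add: \<T>_def test_function_def)
    then show "continuous_map ?S euclideanreal (\<lambda>E. \<Phi> E \<phi>)" using \<phi> by (simp add: \<Phi>_def)
  qed (auto simp: \<Phi>_def)
  have inj: "E = E'" if "Poly_Mapping.keys E \<subseteq> points G" "Poly_Mapping.keys E' \<subseteq> points G" "\<Phi> E = \<Phi> E'" for E E'
  proof (rule divisor_eq_if_divisor_sums_eq[OF G that(1,2)])
    fix \<phi> assume "test_function G \<phi>"
    then show "divisor_sum \<phi> E = divisor_sum \<phi> E'"
      using fun_cong[OF that(3), of \<phi>] by (simp add: \<Phi>_def \<T>_def)
  qed
  have Haus: "Hausdorff_space (powertop_real \<T>)" by (simp add: Hausdorff_space_product_topology)
  have keys: "Poly_Mapping.keys (\<delta> f) \<subseteq> points G" if "f \<in> R_space G D" for f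
    using D lookup_principal_divisor[OF G R_space_rational[OF that]]
    by (auto simp: \<delta>_def is_divisor_def in_keys_iff lookup_add split: if_splits)
  have deg: "divisor_sum (\<lambda>_. 1) (\<delta> f) = of_int (div_degree D)" if "f \<in> R_space G D" for f
    using degree_principal_divisor[OF G R_space_rational[OF that]]
    by (simp add: \<delta>_def divisor_sum_add) (simp add: divisor_sum_def div_degree_def)
  have lin: "linear_system G D = \<delta> ` R_space G D"
    by (simp add: linear_system_def \<delta>_def)
  have sub: "linear_system G D \<subseteq> topspace ?S"
  proof
    fix E assume "E \<in> linear_system G D"
    then obtain f where f: "f \<in> R_space G D" "E = \<delta> f" unfolding lin by blast
    have eff: "effective E" using f by (simp add: R_space_def \<delta>_def)
    \<comment> \<open>Effectivity makes the degree of \<open>D\<close> nonnegative, so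
      \<open>nat\<close> in the symmetric product does not truncate it.\<close>
    then have "0 \<le> divisor_sum (\<lambda>_. 1) E"
      unfolding divisor_sum_def effective_def by (intro sum_nonneg) auto
    then have "divisor_sum (\<lambda>_. 1) E = real (nat (div_degree D))"
      using deg[OF f(1)] f(2) by simp
    then show "E \<in> topspace ?S"
      using eff keys[OF f(1)] f(2) topspace_curve_topology[OF G] by (intro effective_in_sym_product) auto
  qed
  have hom1: "homeomorphic_map (linear_system_topology G D)
      (subtopology (powertop_real \<T>) (\<Phi> ` linear_system G D)) \<Phi>"
    unfolding linear_system_topology_def
  proof (rule homeomorphic_map_from_compact_subset[OF _ Haus cont_\<Phi> _ sub])
    show "compact_space ?S" by (intro compact_space_sym_product compact_space_curve G)
    show "inj_on \<Phi> (topspace ?S)"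
      using keys_sym_product[of _ "curve_topology G"] topspace_curve_topology[OF G]
      by (intro inj_onI inj) auto
  qed
  \<comment> \<open>Translation changes neither membership in R(D) nor the divisor, so the
    normalised functions produce the whole linear system.\<close>
  have based: "based_at (points G) x0 f \<in> R_space G D" "\<delta> (based_at (points G) x0 f) = \<delta> f"
    if "f \<in> R_space G D" for f
  proof -
    have *: "based_at (points G) x0 f = (\<lambda>x\<in>points G. - f x0 + f x)" by (simp add: based_at_def)
    show "based_at (points G) x0 f \<in> R_space G D"
      unfolding * by (rule R_space_add_const[OF G that])
    show "\<delta> (based_at (points G) x0 f) = \<delta> f"
      unfolding * \<delta>_def principal_divisor_add_const[OF G R_space_rational[OF that]] ..
  qed
  have tsR: "topspace (subtopology (powertop_real (points G)) ?R) = ?R"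
    by (auto simp: PiE_def based_at_def)
  have hom2: "homeomorphic_map (subtopology (powertop_real (points G)) ?R)
      (subtopology (powertop_real \<T>) (\<Phi> ` linear_system G D)) (\<lambda>f. \<Phi> (\<delta> f))"
  proof (rule continuous_imp_homeomorphic_map[OF _ compact])
    have im: "(\<lambda>f. \<Phi> (\<delta> f)) ` ?R = \<Phi> ` linear_system G D"
      unfolding lin image_image using based(2) by (intro image_cong) simp_all
    have "continuous_map (subtopology (powertop_real (points G)) ?R) (powertop_real \<T>) (\<lambda>f. \<Phi> (\<delta> f))"
      unfolding continuous_map_componentwise
    proof (intro conjI ballI)
      fix \<phi> assume \<phi>: "\<phi> \<in> \<T>"
      then obtain \<Lambda> where \<Lambda>: "continuous_map (powertop_real (points G)) euclideanreal \<Lambda>"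
        "\<And>f. rational_function G f \<Longrightarrow> divisor_sum \<phi> (principal_divisor G f) = \<Lambda> f"
        unfolding \<T>_def test_function_def by blast
      show "continuous_map (subtopology (powertop_real (points G)) ?R) euclideanreal (\<lambda>f. \<Phi> (\<delta> f) \<phi>)"
      \<comment> \<open>The slopes disappear here: on rational functions the coordinate \<phi>
        agrees with a continuous function of the values of \<open>f\<close>.\<close>
      proof (rule continuous_map_eq)
        show "continuous_map (subtopology (powertop_real (points G)) ?R) euclideanreal
            (\<lambda>f. divisor_sum \<phi> D + \<Lambda> f)"
          by (intro continuous_map_add continuous_map_from_subtopology \<Lambda>(1)) simp
        fix f assume "f \<in> topspace (subtopology (powertop_real (points G)) ?R)"
        then have "rational_function G f" unfolding tsR using based(1) R_space_rational by blast
        then show "divisor_sum \<phi> D + \<Lambda> f = \<Phi> (\<delta> f) \<phi>"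
          using \<phi> \<Lambda>(2) by (simp add: \<Phi>_def \<delta>_def divisor_sum_add)
      qed
    qed (auto simp: \<Phi>_def)
    then show "continuous_map (subtopology (powertop_real (points G)) ?R)
        (subtopology (powertop_real \<T>) (\<Phi> ` linear_system G D)) (\<lambda>f. \<Phi> (\<delta> f))"
      unfolding continuous_map_in_subtopology tsR using im by blast
    show "(\<lambda>f. \<Phi> (\<delta> f)) ` topspace (subtopology (powertop_real (points G)) ?R) =
        topspace (subtopology (powertop_real \<T>) (\<Phi> ` linear_system G D))"
      unfolding tsR im by (auto simp: \<Phi>_def)
    show "inj_on (\<lambda>f. \<Phi> (\<delta> f)) (topspace (subtopology (powertop_real (points G)) ?R))"
      unfolding tsR
    proof (rule inj_onI)
      fix f g assume fR: "f \<in> ?R" and gR: "g \<in> ?R" and eq: "\<Phi> (\<delta> f) = \<Phi> (\<delta> g)"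
      have R: "h \<in> R_space G D" "based_at (points G) x0 h = h" if h: "h \<in> ?R" for h
      proof -
        obtain k where "k \<in> R_space G D" "h = based_at (points G) x0 k" using h by blast
        then show "h \<in> R_space G D" "based_at (points G) x0 h = h" using x0 by (simp_all add: based(1))
      qed
      note f = R[OF fR] and g = R[OF gR]
      have "\<delta> f = \<delta> g" by (rule inj[OF keys[OF f(1)] keys[OF g(1)] eq])
      then have "principal_divisor G f = principal_divisor G g" by (simp add: \<delta>_def)
      from based_at_eq_if_principal_divisor_eq[OF G R_space_rational[OF f(1)] R_space_rational[OF g(1)] this x0]
      show "f = g" by (simp add: f g)
    qed
  qed (intro Hausdorff_space_subtopology Haus)
  from homeomorphic_map_imp_homeomorphic_space[OF hom1] homeomorphic_map_imp_homeomorphic_space[OF hom2]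
  show ?thesis unfolding homeomorphic_space_sym[of "subtopology (powertop_real (points G)) ?R"]
    by (rule homeomorphic_space_trans)
qed

section \<open>Tropical spans\<close>

text \<open>A term that realises the maximum at \<open>i\<close> touches \<open>f\<close> there and
  stays below it everywhere.\<close>

lemma tropical_spanD:
  assumes "f \<in> tropical_span I A" "i \<in> I"
  shows "\<exists>h\<in>A. \<exists>c. f i = c + h i \<and> (\<forall>j\<in>I. c + h j \<le> f j)"
proof -
  obtain S a where S: "finite S" "S \<noteq> {}" "S \<subseteq> A" and f: "f = (\<lambda>i\<in>I. Max ((\<lambda>h. a h + h i) ` S))"
    using assms(1) by (auto simp: tropical_span_def)
  have "Max ((\<lambda>h. a h + h i) ` S) \<in> (\<lambda>h. a h + h i) ` S"
    using S by (intro Max_in) auto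
  then obtain h where h: "h \<in> S" "f i = a h + h i" using f assms(2) by auto
  moreover have "a h + h j \<le> f j" if "j \<in> I" for j
    using h(1) S(1) that unfolding f by simp
  ultimately show ?thesis using S(3) by blast
qed

text \<open>The touching functions, one for each of the finitely many coordinates, have
  \<open>f\<close> as their maximum. Additive constants are already absorbed in the elements of
  \<open>A\<close>, so all coefficients are 0.\<close>

lemma in_tropical_spanI:
  assumes I: "finite I" "I \<noteq> {}" and f: "f \<in> extensional I"
    and "\<And>i. i \<in> I \<Longrightarrow> \<exists>h\<in>A. f i = h i \<and> (\<forall>j\<in>I. h j \<le> f j)"
  shows "f \<in> tropical_span I A"
proof -
  obtain h where h: "\<And>i. i \<in> I \<Longrightarrow> h i \<in> A \<and> f i = h i i \<and> (\<forall>j\<in>I. h i j \<le> f j)"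
    using assms(4) by metis
  have "f i = Max ((\<lambda>h. 0 + h i) ` h ` I)" if "i \<in> I" for i
  proof (rule Max_eqI[symmetric])
    fix u assume "u \<in> (\<lambda>h. 0 + h i) ` h ` I"
    then obtain j where "j \<in> I" "u = h j i" by auto
    then show "u \<le> f i" using h[OF \<open>j \<in> I\<close>] that by simp
  next
    show "f i \<in> (\<lambda>h. 0 + h i) ` h ` I" using h[OF that] that by auto
  qed (use I in auto)
  then have "f = (\<lambda>i\<in>I. Max ((\<lambda>h. (\<lambda>_. 0) h + h i) ` h ` I))"
    using f by (intro extensionalityI[of _ I]) auto
  moreover have "finite (h ` I)" "h ` I \<noteq> {}" "h ` I \<subseteq> A" using h I by auto
  ultimately show ?thesis
    unfolding tropical_span_def by (intro CollectI exI[of _ "h ` I"] exI[of _ "\<lambda>_. 0"] conjI)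
qed

theorem theorem27:
  fixes G :: "('v, 'e) metric_graph"
    and D :: "('v, 'e) point \<Rightarrow>\<^sub>0 int"
    and r :: nat
    and F :: "nat \<Rightarrow> ('v, 'e) point \<Rightarrow> real"
  assumes "tropical_curve G"
    and "is_divisor G D"
    and "r \<ge> 1"
    and "generates_R G D r F"
  shows "linear_system_topology G D homeomorphic_space
           subtopology (mod_const {..<r}) (tropical_hull {..<r} (phi r F ` points G))
       \<and> R_mod_const G D homeomorphic_space
           subtopology (mod_const {..<r}) (tropical_hull {..<r} (phi r F ` points G))"
proof -
  note G = assms(1) and D = assms(2)
  let ?X = "points G" and ?I = "{..<r}" and ?R = "R_space G D"
  have i0: "0 \<in> ?I" using assms(3) by simp
  then have I: "finite ?I" "?I \<noteq> {}" by blast+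
  obtain v where "v \<in> verts G" using tropical_curveD(2)[OF G] by blast
  define x0 :: "('v, 'e) point" where "x0 = Vertex v"
  have x0: "x0 \<in> ?X" using \<open>v \<in> verts G\<close> by (simp add: x0_def)
  have F: "F i \<in> ?R" if "i \<in> ?I" for i
    using assms(4) that by (auto simp: generates_R_def)
  \<comment> \<open>Compactness of the curve provides these maxima; they bound the |F i| and also
    make the suprema in the duality maxima.\<close>
  have attained: "\<exists>x\<in>?X. \<forall>y\<in>?X. f y \<le> f x" if "continuous_map (curve_topology G) euclideanreal f" for f
  proof -
    have "compact (f ` ?X)"
      using image_compactin[OF _ that, of ?X] compact_space_curve[OF G]
      by (simp add: compact_space_def topspace_curve_topology[OF G])
    then obtain u where "u \<in> f ` ?X" "\<forall>w\<in>f ` ?X. w \<le> u"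
      using compact_attains_sup[of "f ` ?X"] x0 by auto
    then show ?thesis by auto
  qed
  have cont: "continuous_map (curve_topology G) euclideanreal f" if "f \<in> ?R" for f
    using rational_functionD(2)[OF R_space_rational[OF that]] .
  have "\<exists>K. \<forall>x\<in>?X. \<bar>F i x\<bar> \<le> K" if "i \<in> ?I" for i
    using attained[of "\<lambda>x. \<bar>F i x\<bar>"] cont[OF F[OF that]] continuous_map_real_abs by blast
  then obtain k where k: "\<And>i x. i \<in> ?I \<Longrightarrow> x \<in> ?X \<Longrightarrow> \<bar>F i x\<bar> \<le> k i" by metis
  have "tropical_pairing ?X ?I F ?R (Max (k ` ?I))"
  proof
    show "\<bar>F i x\<bar> \<le> Max (k ` ?I)" if "i \<in> ?I" "x \<in> ?X" for i x
      by (rule order_trans[OF k[OF that] Max_ge]) (use that in auto)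
    show "?R \<subseteq> extensional ?X" by (auto intro: rational_functionD(1) R_space_rational)
    show "\<exists>i\<in>?I. \<exists>a. f x = a + F i x \<and> (\<forall>y\<in>?X. a + F i y \<le> f y)" if "f \<in> ?R" "x \<in> ?X" for f x
    proof -
      have "f \<in> tropical_span ?X (F ` ?I)" using assms(4) that by (auto simp: generates_R_def)
      from tropical_spanD[OF this that(2)] show ?thesis by blast
    qed
    show "(\<lambda>x\<in>?X. Max ((\<lambda>i. F i x - y i) ` ?I)) \<in> ?R" for y
    proof -
      have "(\<lambda>x\<in>?X. Max ((\<lambda>i. (\<lambda>x\<in>?X. - y i + F i x) x) ` ?I)) \<in> ?R"
        by (intro R_space_Max[OF G D I] R_space_add_const[OF G F])
      also have "(\<lambda>x\<in>?X. Max ((\<lambda>i. (\<lambda>x\<in>?X. - y i + F i x) x) ` ?I)) = (\<lambda>x\<in>?X. Max ((\<lambda>i. F i x - y i) ` ?I))"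
        by (rule restrict_ext) simp
      finally show ?thesis .
    qed
    show "\<exists>x\<in>?X. \<forall>y\<in>?X. F i y - f y \<le> F i x - f x" if "f \<in> ?R" "i \<in> ?I" for f i
      using attained[OF continuous_map_diff[OF cont[OF F[OF that(2)]] cont[OF that(1)]]] .
  qed (use x0 I in auto)
  then interpret tropical_pairing ?X ?I F ?R "Max (k ` ?I)" .
  \<comment> \<open>The hull is generated by all representatives of the classes, so the columns
    occur with arbitrary additive constants.\<close>
  have phi: "\<Union> (phi r F ` ?X) = {h. \<exists>x\<in>?X. \<exists>c. h = (\<lambda>i\<in>?I. c + F i x)}"
    by (auto simp: phi_def const_class_def add.commute cong: restrict_cong)
  have H: "tropical_span ?I (\<Union> (phi r F ` ?X)) = H"
  proof
    show "tropical_span ?I (\<Union> (phi r F ` ?X)) \<subseteq> H"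
    proof
      fix y assume y: "y \<in> tropical_span ?I (\<Union> (phi r F ` ?X))"
      then have "y \<in> extensional ?I" by (auto simp: tropical_span_def)
      moreover have "\<exists>x\<in>?X. \<exists>c. y i = c + F i x \<and> (\<forall>j\<in>?I. c + F j x \<le> y j)" if i: "i \<in> ?I" for i
      proof -
        obtain x b c where *: "x \<in> ?X" "y i = c + (\<lambda>i\<in>?I. b + F i x) i"
          "\<forall>j\<in>?I. c + (\<lambda>i\<in>?I. b + F i x) j \<le> y j"
          using tropical_spanD[OF y i] unfolding phi by blast
        then show ?thesis using i by (intro bexI[of _ x] exI[of _ "c + b"]) (auto simp: add.assoc)
      qed
      ultimately show "y \<in> H" unfolding H_def by blast
    qed
    show "H \<subseteq> tropical_span ?I (\<Union> (phi r F ` ?X))"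
    proof
      fix y assume y: "y \<in> H"
      show "y \<in> tropical_span ?I (\<Union> (phi r F ` ?X))"
      \<comment> \<open>The constant \<open>c\<close> of each touching column goes into the
        representative.\<close>
      proof (rule in_tropical_spanI[OF I])
        show "y \<in> extensional ?I" using y H_ext by blast
        fix i assume i: "i \<in> ?I"
        then obtain x c where "x \<in> ?X" "y i = c + F i x" "\<forall>j\<in>?I. c + F j x \<le> y j"
          using y unfolding H_def by blast
        then show "\<exists>h\<in>\<Union> (phi r F ` ?X). y i = h i \<and> (\<forall>j\<in>?I. h j \<le> y j)"
          unfolding phi using i by (intro bexI[of _ "\<lambda>i\<in>?I. c + F i x"]) auto
      qed
    qed
  qed
  let ?hull = "subtopology (mod_const ?I) (tropical_hull ?I (phi r F ` ?X))"
  \<comment> \<open>The common model: normalised functions with pointwise convergence. Both asserted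
    homeomorphisms pass through it.\<close>
  let ?R0 = "subtopology (powertop_real ?X) (based_at ?X x0 ` ?R)"
  have "?hull homeomorphic_space subtopology (powertop_real ?I) (based_at ?I 0 ` H)"
    unfolding tropical_hull_def H by (rule homeomorphic_space_mod_const[OF i0 H_ext])
  moreover have "subtopology (powertop_real ?I) (based_at ?I 0 ` H) homeomorphic_space ?R0"
    by (rule homeomorphic_map_imp_homeomorphic_space[OF homeomorphic_map_based[OF i0 x0]])
  ultimately have "?hull homeomorphic_space ?R0" by (rule homeomorphic_space_trans)
  then have hull: "?R0 homeomorphic_space ?hull" by (rule homeomorphic_space_sym[THEN iffD1])
  show ?thesis
  proof
    have "linear_system_topology G D homeomorphic_space ?R0"
      by (rule linear_system_homeomorphic_based_R_space[OF G D x0 compact_space_based_R[OF x0]])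
    then show "linear_system_topology G D homeomorphic_space ?hull"
      using hull by (rule homeomorphic_space_trans)
    have "R_mod_const G D homeomorphic_space ?R0"
      unfolding R_mod_const_def by (rule homeomorphic_space_mod_const[OF x0 R_ext])
    then show "R_mod_const G D homeomorphic_space ?hull"
      using hull by (rule homeomorphic_space_trans)
  qed
qed

end
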